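(* Let $\mathcal{H}$ be a real finite-dimensional Hilbert space, $A:\mathcal{H}\to\mathcal{H}$, $g:\mathcal{H}\to(-\infty,+\infty]$, $h:\mathcal{H}\to(-\infty,+\infty]$, and let $S$ be the set of $w^*\in\mathcal{H}$ such that $\langle A(w^* ),w-w^*\rangle+g(w)-g(w^* )\ge 0$ for all $w\in\mathcal{H}$. Suppose that: (A.1) $g$ is proper, convex and lower semicontinuous; (A.2) $h$ is continuously differentiable (on $\operatorname{int}\operatorname{dom}h$), Legendre and $\alpha$-strongly convex for some $\alpha>0$, and for every sequence $(u_n)\subseteq\operatorname{int}\operatorname{dom}h$ converging to some $u\in\operatorname{dom}h$ one has $B_h(u,u_n)\to0$; (A.3) $A$ is monotone and $L$-Lipschitz continuous on $\operatorname{dom}g\cap\operatorname{int}\operatorname{dom}h\neq\emptyset$; (A.4) $\mathcal{S}:=S\cap\operatorname{dom}h\neq\emptyset$. Assume furthermore that for some $\sigma>0$, $$\langle A(z)-A(w),z-w\rangle\ge\sigma B_h(z,w)\qquad\forall (z,w)\in\operatorname{dom}h\times\operatorname{int}\operatorname{dom}h.$$ Then $\mathcal{S}$ consists of a unique point, and the sequences $(w_k)$ and $(\bar w_k)$ generated by the Modified B-GRAAL algorithm (defined in the context) converge R-linearly to the unique point in $\mathcal{S}$.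
   Context: Notation: $\operatorname{dom}g=\{x: g(x)<+\infty\}$; a solution $w^*\in S$ is understood to satisfy $g(w^* )<+\infty$. The Bregman distance of $h$ is $B_h(x,y)=h(x)-h(y)-\langle\nabla h(y),x-y\rangle$ for $x\in\mathcal{H}$, $y\in\operatorname{int}\operatorname{dom}h$. "Legendre" is meant in the usual convex-analysis sense (proper, lower semicontinuous, convex, essentially smooth and essentially strictly convex). $\phi=\frac{\sqrt5+1}{2}$ is the golden ratio. A sequence $(x_k)$ converges R-linearly to $x$ if there are $C>0$ and $q\in(0,1)$ with $\|x_k-x\|\le Cq^k$ for all $k$. Modified B-GRAAL algorithm. Initialization: choose $\lambda_0>0$, $0<\eta_1<\eta_0<\frac{\phi}{2}$, and a sequence $(\gamma_k)_{k\ge0}$ of positive reals with $\sum_{k=0}^{\infty}\gamma_k<+\infty$. Choose $w_0=\bar w_0\in\operatorname{int}\operatorname{dom}h$ and $w_1\in\operatorname{int}\operatorname{dom}h$. For $k=1,2,\dots$: Step 1: if $\|A(w_k)-A(w_{k-1})\|>\frac{\eta_0\alpha}{\lambda_{k-1}}\|w_k-w_{k-1}\|$, set $\lambda_k=\eta_1\alpha\frac{\|w_k-w_{k-1}\|}{\|A(w_k)-A(w_{k-1})\|}$; otherwise set $\lambda_k=(1+\gamma_{k-1})\lambda_{k-1}$. Step 2: set $\bar w_k=(\nabla h)^{-1}\!\left(\frac{(\phi-1)\nabla h(w_k)+\nabla h(\bar w_{k-1})}{\phi}\right)$ and $w_{k+1}=\operatorname{argmin}_{w\in\mathcal{H}}\left\{\langle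 A(w_k),w-w_k\rangle+g(w)+\frac1{\lambda_k}B_h(w,\bar w_k)\right\}$. *)

theory Defs
  imports "HOL-Analysis.Analysis"
begin

section \<open>Extended-real-valued convex functions\<close>

text \<open>
  Functions with values in the half-open interval from minus infinity (excluded) to plus infinity
  (included) are rendered as functions into \<^typ>\<open>ereal\<close>; that minus infinity is not attained is
  part of properness. In the (strong, strict) convexity inequalities the weights are
  strictly between 0 and 1, so no product of 0 with infinity occurs.
\<close>

definition edom :: "('a \<Rightarrow> ereal) \<Rightarrow> 'a set" where
  "edom f = {x. f x < \<infinity>}"

definition proper_fun :: "('a \<Rightarrow> ereal) \<Rightarrow> bool" where
  "proper_fun f \<longleftrightarrow> (\<forall>x. f x \<noteq> -\<infinity>) \<and> edom f \<noteq> {}"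

definition lsc_fun :: "('a::topological_space \<Rightarrow> ereal) \<Rightarrow> bool" where
  "lsc_fun f \<longleftrightarrow> (\<forall>x. f x \<le> Liminf (nhds x) f)"

definition econvex :: "('a::real_vector \<Rightarrow> ereal) \<Rightarrow> bool" where
  "econvex f \<longleftrightarrow> (\<forall>x y t. 0 < t \<and> t < 1 \<longrightarrow>
     f ((1 - t) *\<^sub>R x + t *\<^sub>R y) \<le> ereal (1 - t) * f x + ereal t * f y)"

definition strongly_econvex :: "real \<Rightarrow> ('a::real_normed_vector \<Rightarrow> ereal) \<Rightarrow> bool" where
  "strongly_econvex \<alpha> f \<longleftrightarrow> (\<forall>x y t. 0 < t \<and> t < 1 \<longrightarrow>
     f ((1 - t) *\<^sub>R x + t *\<^sub>R y) + ereal (\<alpha> / 2 * t * (1 - t) * (norm (x - y))\<^sup>2)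
       \<le> ereal (1 - t) * f x + ereal t * f y)"

definition strictly_econvex_on :: "'a::real_vector set \<Rightarrow> ('a \<Rightarrow> ereal) \<Rightarrow> bool" where
  "strictly_econvex_on C f \<longleftrightarrow> (\<forall>x\<in>C. \<forall>y\<in>C. \<forall>t. x \<noteq> y \<and> 0 < t \<and> t < 1 \<longrightarrow>
     f ((1 - t) *\<^sub>R x + t *\<^sub>R y) < ereal (1 - t) * f x + ereal t * f y)"

definition subdiff :: "('a::real_inner \<Rightarrow> ereal) \<Rightarrow> 'a \<Rightarrow> 'a set" where
  "subdiff f x = {v. \<forall>y. f x + ereal (v \<bullet> (y - x)) \<le> f y}"

text \<open>
  Gradients are taken of the real-valued function underlying \<open>f\<close>. They are used only on the
  interior of the domain, near whose points a proper \<open>f\<close> is finite.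
\<close>

definition has_egradient :: "('a::real_inner \<Rightarrow> ereal) \<Rightarrow> 'a \<Rightarrow> 'a \<Rightarrow> bool" where
  "has_egradient f x v \<longleftrightarrow> GDERIV (\<lambda>y. real_of_ereal (f y)) x :> v"

definition egrad :: "('a::real_inner \<Rightarrow> ereal) \<Rightarrow> 'a \<Rightarrow> 'a" where
  "egrad f x = (THE v. has_egradient f x v)"

definition cont_diff_on_int_dom :: "('a::real_inner \<Rightarrow> ereal) \<Rightarrow> bool" where
  "cont_diff_on_int_dom f \<longleftrightarrow>
     (\<forall>x\<in>interior (edom f). \<exists>v. has_egradient f x v) \<and>
     continuous_on (interior (edom f)) (egrad f)"

text \<open>Essential smoothness and essential strict convexity are in the sense of Rockafellar.\<close>

definition essentially_smooth :: "('a::real_inner \<Rightarrow> ereal) \<Rightarrow> bool" where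
  "essentially_smooth f \<longleftrightarrow>
     interior (edom f) \<noteq> {} \<and>
     (\<forall>x\<in>interior (edom f). \<exists>v. has_egradient f x v) \<and>
     (\<forall>u x. (\<forall>n::nat. u n \<in> interior (edom f)) \<and> x \<in> frontier (interior (edom f)) \<and> u \<longlonglongrightarrow> x
        \<longrightarrow> filterlim (\<lambda>n. norm (egrad f (u n))) at_top sequentially)"

definition essentially_strictly_convex :: "('a::real_inner \<Rightarrow> ereal) \<Rightarrow> bool" where
  "essentially_strictly_convex f \<longleftrightarrow>
     (\<forall>C. convex C \<and> C \<subseteq> {x. subdiff f x \<noteq> {}} \<longrightarrow> strictly_econvex_on C f)"

definition legendre_fun :: "('a::real_inner \<Rightarrow> ereal) \<Rightarrow> bool" where
  "legendre_fun f \<longleftrightarrow> proper_fun f \<and> lsc_fun f \<and> econvex f \<and>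
     essentially_smooth f \<and> essentially_strictly_convex f"

definition bregman :: "('a::real_inner \<Rightarrow> ereal) \<Rightarrow> 'a \<Rightarrow> 'a \<Rightarrow> ereal" where
  "bregman h x y = h x - h y - ereal (egrad h y \<bullet> (x - y))"

section \<open>The variational inequality and the algorithm\<close>

definition monotone_operator_on :: "'a::real_inner set \<Rightarrow> ('a \<Rightarrow> 'a) \<Rightarrow> bool" where
  "monotone_operator_on X A \<longleftrightarrow> (\<forall>x\<in>X. \<forall>y\<in>X. 0 \<le> (A x - A y) \<bullet> (x - y))"

definition vi_solutions :: "('a::real_inner \<Rightarrow> 'a) \<Rightarrow> ('a \<Rightarrow> ereal) \<Rightarrow> 'a set" where
  "vi_solutions A g =
     {z. g z < \<infinity> \<and> (\<forall>w. 0 \<le> ereal (A z \<bullet> (w - z)) + g w - g z)}"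

definition golden_ratio :: real where
  "golden_ratio = (sqrt 5 + 1) / 2"

text \<open>
  The inverse gradient and the minimizer are total operators here (\<^const>\<open>inv_into\<close> on the
  interior of the domain, and \<^const>\<open>arg_min\<close> over the whole space). That the preimage and the
  minimizer exist and are unique is not assumed in the definition.
\<close>

definition modified_bgraal ::
  "('a::real_inner \<Rightarrow> 'a) \<Rightarrow> ('a \<Rightarrow> ereal) \<Rightarrow> ('a \<Rightarrow> ereal) \<Rightarrow> real \<Rightarrow> real \<Rightarrow> real \<Rightarrow>
   (nat \<Rightarrow> real) \<Rightarrow> (nat \<Rightarrow> real) \<Rightarrow> (nat \<Rightarrow> 'a) \<Rightarrow> (nat \<Rightarrow> 'a) \<Rightarrow> bool" where
  "modified_bgraal A g h \<alpha> \<eta>0 \<eta>1 \<gamma> lam w wbar \<longleftrightarrow>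
     lam 0 > 0 \<and> 0 < \<eta>1 \<and> \<eta>1 < \<eta>0 \<and> \<eta>0 < golden_ratio / 2 \<and>
     (\<forall>k. 0 < \<gamma> k) \<and> summable \<gamma> \<and>
     w 0 = wbar 0 \<and> wbar 0 \<in> interior (edom h) \<and> w 1 \<in> interior (edom h) \<and>
     (\<forall>k\<ge>1.
        lam k =
          (if norm (A (w k) - A (w (k - 1))) > \<eta>0 * \<alpha> / lam (k - 1) * norm (w k - w (k - 1))
           then \<eta>1 * \<alpha> * (norm (w k - w (k - 1)) / norm (A (w k) - A (w (k - 1))))
           else (1 + \<gamma> (k - 1)) * lam (k - 1)) \<and>
        wbar k = inv_into (interior (edom h)) (egrad h)
          ((1 / golden_ratio) *\<^sub>R
             ((golden_ratio - 1) *\<^sub>R egrad h (w k) + egrad h (wbar (k - 1)))) \<and>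
        w (k + 1) = arg_min
          (\<lambda>v. ereal (A (w k) \<bullet> (v - w k)) + g v + ereal (1 / lam k) * bregman h v (wbar k))
          (\<lambda>_. True))"

definition R_linearly_convergent :: "(nat \<Rightarrow> 'a::real_normed_vector) \<Rightarrow> 'a \<Rightarrow> bool" where
  "R_linearly_convergent x l \<longleftrightarrow>
     (\<exists>C>0. \<exists>q. 0 < q \<and> q < 1 \<and> (\<forall>k. norm (x k - l) \<le> C * q ^ k))"

end

theory Submission
  imports Defs
begin

text \<open>
  Fix a solution \<open>p\<close> and write \<open>D\<close> for the Bregman distance of \<open>h\<close>. Essential smoothness and strong
  convexity put all iterates in the interior of the domain of \<open>h\<close>, where the minimization step is
  characterized by a variational inequality. Since the step sizes are bounded below and their total
  growth is bounded, from some index on the step size is never reduced and its consecutive ratios tend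
  to 1. From there on, with \<open>\<eta> = \<eta>0 < \<phi> / 2\<close>, the quantity
  \<open>(\<phi> + 1) D(p, wbar\<^sub>k) - \<phi> D(w\<^sub>k, wbar\<^sub>k) + (\<phi> - \<eta>) D(w\<^sub>k, w\<^sub>k\<^sub>-\<^sub>1)\<close> is nonnegative and decreases in each
  step by at least a multiple of \<open>D(p, w\<^sub>k) + D(w\<^sub>k, w\<^sub>k\<^sub>-\<^sub>1)\<close>; the term \<open>D(p, w\<^sub>k)\<close> comes from the strong
  monotonicity of \<open>A\<close> relative to \<open>h\<close>. The averaging identity for \<open>wbar\<^sub>k\<close> contracts \<open>D(p, wbar\<^sub>k)\<close> by
  the factor \<open>1 / \<phi>\<close> up to a multiple of \<open>D(p, w\<^sub>k)\<close>, so a small correction of this quantity contracts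
  geometrically. As the iterates converge to every solution \<open>p\<close>, the solution is unique.
\<close>

section \<open>Semicontinuous and strongly convex functions\<close>

lemma edomE:
  assumes "proper_fun f" "x \<in> edom f"
  obtains r where "f x = ereal r"
  using assms by (cases "f x") (auto simp: proper_fun_def edom_def)

lemma lsc_funI:
  assumes "\<And>x c. ereal c < f x \<Longrightarrow> \<forall>\<^sub>F y in nhds x. ereal c < f y"
  shows "lsc_fun f"
  unfolding lsc_fun_def le_Liminf_iff
proof (intro allI impI)
  fix x y assume "y < f x"
  then obtain z where z: "y < ereal z" "ereal z < f x" using ereal_dense2 by blast
  from assms[OF z(2)] show "\<forall>\<^sub>F v in nhds x. y < f v"
    by eventually_elim (use z in auto)
qed

lemma lsc_funD: "lsc_fun f \<Longrightarrow> c < f x \<Longrightarrow> \<forall>\<^sub>F y in nhds x. c < f y"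
  unfolding lsc_fun_def le_Liminf_iff by blast

text \<open>A real level \<open>c\<close> below the sum is split into a level \<open>z\<close> below
  \<open>g x\<close> and a level \<open>c - z\<close> below \<open>f x\<close>; both persist nearby
  and add up. If \<open>f x\<close> is infinite, any real \<open>z\<close> below \<open>g x\<close>
  will do.\<close>

lemma lsc_fun_add:
  assumes "lsc_fun f" "lsc_fun g" "\<And>x. f x \<noteq> -\<infinity>" "\<And>x. g x \<noteq> -\<infinity>"
  shows "lsc_fun (\<lambda>x. f x + g x)"
proof (rule lsc_funI)
  fix x c assume c: "ereal c < f x + g x"
  obtain z where z: "ereal z < g x" "ereal (c - z) < f x"
  proof (cases "f x")
    case (real r)
    with c have "ereal (c - r) < g x" by (cases "g x") auto
    then obtain z where "ereal (c - r) < ereal z" "ereal z < g x" using ereal_dense2 by blast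
    with real show ?thesis by (intro that[of z]) auto
  next
    case PInf
    obtain z where "ereal z < g x"
      using ereal_dense2[of "-\<infinity>" "g x"] assms(4)[of x] by auto
    with PInf show ?thesis by (intro that[of z]) auto
  qed (use assms in auto)
  show "\<forall>\<^sub>F y in nhds x. ereal c < f y + g y"
    using lsc_funD[OF assms(1) z(2)] lsc_funD[OF assms(2) z(1)]
  proof eventually_elim
    case (elim y)
    have "ereal c = ereal (c - z) + ereal z" by simp
    also have "\<dots> < f y + g y" using elim by (intro ereal_add_strict_mono2) auto
    finally show ?case .
  qed
qed

lemma lsc_fun_cmult:
  assumes "lsc_fun f" "0 < c"
  shows "lsc_fun (\<lambda>x. ereal c * f x)"
proof (rule lsc_funI)
  fix x b assume "ereal b < ereal c * f x"
  then have "ereal (b / c) < f x" using assms(2) by (cases "f x") (auto simp: field_simps)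
  from lsc_funD[OF assms(1) this] show "\<forall>\<^sub>F y in nhds x. ereal b < ereal c * f y"
  proof eventually_elim
    case (elim y)
    then show ?case using assms(2) by (cases "f y") (auto simp: field_simps)
  qed
qed

lemma lsc_fun_continuous:
  assumes "continuous_on UNIV f"
  shows "lsc_fun (\<lambda>x. ereal (f x))"
proof (rule lsc_funI)
  fix x c assume "ereal c < ereal (f x)"
  moreover have "(f \<longlongrightarrow> f x) (nhds x)"
    using assms by (auto simp: continuous_on_def tendsto_nhds_iff)
  ultimately show "\<forall>\<^sub>F y in nhds x. ereal c < ereal (f y)"
    using order_tendstoD(1) by auto
qed

text \<open>Without a minimizer, every point of \<open>K\<close> has a neighbourhood on which
  \<open>f\<close> stays above some value \<open>f (Y x)\<close> attained in \<open>K\<close>. A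
  finite subcover leaves finitely many such values, and the smallest of them is undercut at its own
  point.\<close>

lemma lsc_fun_attains_inf:
  fixes f :: "'a::metric_space \<Rightarrow> ereal"
  assumes "lsc_fun f" "compact K" "K \<noteq> {}"
  shows "\<exists>x\<in>K. \<forall>y\<in>K. f x \<le> f y"
proof (rule ccontr)
  assume contr: "\<not> ?thesis"
  have *: "\<exists>y\<in>K. f y < f x" if "x \<in> K" for x
    using contr that by (meson not_le)
  have "\<exists>U y. open U \<and> x \<in> U \<and> y \<in> K \<and> (\<forall>z\<in>U. f y < f z)" if xK: "x \<in> K" for x
  proof -
    obtain y where y: "y \<in> K" "f y < f x" using *[OF xK] by blast
    from lsc_funD[OF assms(1) y(2)] obtain U where "open U" "x \<in> U" "\<forall>z\<in>U. f y < f z"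
      unfolding eventually_nhds by blast
    with y(1) show ?thesis by blast
  qed
  then obtain U Y where UY: "\<forall>x\<in>K. open (U x) \<and> x \<in> U x \<and> Y x \<in> K \<and> (\<forall>z\<in>U x. f (Y x) < f z)"
    by metis
  have U: "\<And>x. x \<in> K \<Longrightarrow> open (U x)" "K \<subseteq> (\<Union>x\<in>K. U x)"
    and Y: "\<And>x. x \<in> K \<Longrightarrow> Y x \<in> K" "\<And>x z. x \<in> K \<Longrightarrow> z \<in> U x \<Longrightarrow> f (Y x) < f z"
    using UY by blast+
  obtain F where F: "F \<subseteq> K" "finite F" "K \<subseteq> (\<Union>x\<in>F. U x)"
    using compactE_image[OF assms(2) U(1) U(2)] by metis
  have "F \<noteq> {}" using F assms(3) by auto
  then have "Min (f ` Y ` F) \<in> f ` Y ` F" using F by (intro Min_in) auto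
  then obtain x where x: "x \<in> F" "f (Y x) = Min (f ` Y ` F)" by (metis imageE)
  have "Y x \<in> K" using x F Y(1) by blast
  then obtain x' where x': "x' \<in> F" "Y x \<in> U x'" using F by blast
  have "f (Y x') < f (Y x)" using Y(2) x' F by blast
  moreover have "f (Y x) \<le> f (Y x')" using x x' F by auto
  ultimately show False by simp
qed

text \<open>Strong convexity gives coercivity: \<open>f\<close> is bounded below on the unit ball
  around \<open>x0\<close>, so the quadratic term forces \<open>f x0 \<le> f y\<close> for distant
  \<open>y\<close>. A minimizer over a large closed ball is then global.\<close>

lemma strongly_econvex_attains_inf:
  fixes f :: "'a::euclidean_space \<Rightarrow> ereal"
  assumes lsc: "lsc_fun f" and pr: "proper_fun f" and sc: "strongly_econvex \<alpha> f" and \<alpha>: "\<alpha> > 0"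
  shows "\<exists>x\<in>edom f. \<forall>y. f x \<le> f y"
proof -
  obtain x0 where x0: "x0 \<in> edom f" using pr by (auto simp: proper_fun_def)
  have ninf: "f y \<noteq> -\<infinity>" for y using pr by (auto simp: proper_fun_def)
  obtain r0 where r0: "f x0 = ereal r0" using edomE[OF pr x0] .
  have "cball x0 1 \<noteq> {}" by auto
  from lsc_fun_attains_inf[OF lsc compact_cball this]
  obtain x1 where x1: "\<And>y. y \<in> cball x0 1 \<Longrightarrow> f x1 \<le> f y"
    by blast
  obtain r1 where r1: "f x1 = ereal r1" using x1[of x0] r0 ninf[of x1] by (cases "f x1") auto
  \<comment> \<open>The second entry gives \<open>r0 - r1 \<le> \<alpha> / 2 * (\<rho> - 1)\<close>
    whenever \<open>\<rho> > R\<close>; the first keeps \<open>1 / \<rho>\<close> a proper convex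
    weight.\<close>
  define R where "R = max 2 (2 * (r0 - r1) / \<alpha> + 1)"
  have R: "R \<ge> 2" "2 * (r0 - r1) / \<alpha> + 1 \<le> R" by (auto simp: R_def)
  have far: "f x0 \<le> f y" if y: "norm (y - x0) > R" for y
  proof (cases "f y")
    case (real ry)
    define \<rho> where "\<rho> = norm (y - x0)"
    have \<rho>: "\<rho> > R" "\<rho> > 1" using y R by (auto simp: \<rho>_def)
    \<comment> \<open>This is the point of the segment from \<open>x0\<close> to \<open>y\<close> at
      distance 1 from \<open>x0\<close>, where \<open>r1\<close> is a lower bound.\<close>
    define z where "z = (1 - 1 / \<rho>) *\<^sub>R x0 + (1 / \<rho>) *\<^sub>R y"
    have "z - x0 = (1 / \<rho>) *\<^sub>R (y - x0)" by (simp add: z_def algebra_simps)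
    then have "norm (z - x0) = 1" using \<rho> by (auto simp: \<rho>_def)
    then have "ereal r1 \<le> f z" using x1[of z] r1 by (simp add: dist_norm norm_minus_commute)
    moreover have "f z + ereal (\<alpha> / 2 * (1 / \<rho>) * (1 - 1 / \<rho>) * (norm (x0 - y))\<^sup>2)
        \<le> ereal (1 - 1 / \<rho>) * f x0 + ereal (1 / \<rho>) * f y"
      unfolding z_def by (rule sc[unfolded strongly_econvex_def, rule_format]) (use \<rho> in auto)
    ultimately have "r1 + \<alpha> / 2 * (1 / \<rho>) * (1 - 1 / \<rho>) * \<rho>\<^sup>2 \<le> (1 - 1 / \<rho>) * r0 + 1 / \<rho> * ry"
      unfolding r0 real by (cases "f z") (auto simp: \<rho>_def norm_minus_commute)
    then have "\<rho> * (r1 + \<alpha> / 2 * (1 / \<rho>) * (1 - 1 / \<rho>) * \<rho>\<^sup>2) \<le> \<rho> * ((1 - 1 / \<rho>) * r0 + 1 / \<rho> * ry)"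
      using \<rho> by (intro mult_left_mono) auto
    moreover have "\<rho> * (r1 + \<alpha> / 2 * (1 / \<rho>) * (1 - 1 / \<rho>) * \<rho>\<^sup>2) = \<rho> * r1 + \<alpha> / 2 * (\<rho> - 1) * \<rho>"
      using \<rho> by (simp add: field_simps power2_eq_square)
    moreover have "\<rho> * ((1 - 1 / \<rho>) * r0 + 1 / \<rho> * ry) = (\<rho> - 1) * r0 + ry"
      using \<rho> by (simp add: field_simps)
    ultimately have "\<rho> * r1 + \<alpha> / 2 * (\<rho> - 1) * \<rho> \<le> (\<rho> - 1) * r0 + ry" by simp
    moreover have "r0 - r1 \<le> \<alpha> / 2 * (\<rho> - 1)"
      using order_trans[OF R(2) less_imp_le[OF \<rho>(1)]] \<alpha> by (simp add: field_simps)
    then have "(r0 - r1) * \<rho> \<le> \<alpha> / 2 * (\<rho> - 1) * \<rho>" using \<rho> by (intro mult_right_mono) auto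
    ultimately have "\<rho> * r1 + (r0 - r1) * \<rho> \<le> (\<rho> - 1) * r0 + ry" by linarith
    then show ?thesis using real r0 by (simp add: algebra_simps)
  qed (use ninf in auto)
  have "cball x0 R \<noteq> {}" using R by auto
  from lsc_fun_attains_inf[OF lsc compact_cball this]
  obtain x where x: "x \<in> cball x0 R" "\<And>y. y \<in> cball x0 R \<Longrightarrow> f x \<le> f y"
    by blast
  have x_x0: "f x \<le> f x0" using x(2)[of x0] R by simp
  have "f x \<le> f y" for y
  proof (cases "y \<in> cball x0 R")
    case False
    then have "f x0 \<le> f y" by (intro far) (simp add: dist_norm norm_minus_commute)
    with x_x0 show ?thesis by simp
  qed (use x in auto)
  moreover have "x \<in> edom f" using x_x0 r0 by (auto simp: edom_def)
  ultimately show ?thesis by blast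
qed

section \<open>Real-valued forms of the convexity inequalities, and uniqueness of gradients\<close>

lemma bregman_real:
  assumes "proper_fun h" "x \<in> edom h" "y \<in> edom h"
  shows "bregman h x y =
    ereal (real_of_ereal (h x) - real_of_ereal (h y) - egrad h y \<bullet> (x - y))"
  by (rule edomE[OF assms(1,2)], rule edomE[OF assms(1,3)]) (simp add: bregman_def)

lemma econvexD_real:
  assumes "econvex f" "proper_fun f" "x \<in> edom f" "y \<in> edom f" "0 < t" "t < 1"
  shows "(1 - t) *\<^sub>R x + t *\<^sub>R y \<in> edom f" (is "?z \<in> _")
    and "real_of_ereal (f ((1 - t) *\<^sub>R x + t *\<^sub>R y))
      \<le> (1 - t) * real_of_ereal (f x) + t * real_of_ereal (f y)"
proof -
  obtain a b where ab: "f x = ereal a" "f y = ereal b"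
    using assms by (meson edomE)
  have *: "f ?z \<le> ereal (1 - t) * f x + ereal t * f y"
    using assms unfolding econvex_def by blast
  then show "?z \<in> edom f" by (auto simp: edom_def ab)
  then obtain c where "f ?z = ereal c" using assms(2) by (meson edomE)
  with * show "real_of_ereal (f ?z) \<le> (1 - t) * real_of_ereal (f x) + t * real_of_ereal (f y)"
    by (simp add: ab)
qed

lemma strongly_econvexD_real:
  assumes "strongly_econvex \<alpha> f" "proper_fun f" "x \<in> edom f" "y \<in> edom f" "0 < t" "t < 1"
  shows "(1 - t) *\<^sub>R x + t *\<^sub>R y \<in> edom f" (is "?z \<in> _")
    and "real_of_ereal (f ((1 - t) *\<^sub>R x + t *\<^sub>R y)) + \<alpha> / 2 * t * (1 - t) * (norm (x - y))\<^sup>2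
      \<le> (1 - t) * real_of_ereal (f x) + t * real_of_ereal (f y)"
proof -
  obtain a b where ab: "f x = ereal a" "f y = ereal b"
    using assms by (meson edomE)
  have *: "f ?z + ereal (\<alpha> / 2 * t * (1 - t) * (norm (x - y))\<^sup>2) \<le> ereal (1 - t) * f x + ereal t * f y"
    using assms unfolding strongly_econvex_def by blast
  then show "?z \<in> edom f" by (cases "f ?z") (auto simp: edom_def ab)
  then obtain c where "f ?z = ereal c" using assms(2) by (meson edomE)
  with * show "real_of_ereal (f ?z) + \<alpha> / 2 * t * (1 - t) * (norm (x - y))\<^sup>2
      \<le> (1 - t) * real_of_ereal (f x) + t * real_of_ereal (f y)"
    by (simp add: ab)
qed

lemma has_egradient_unique:
  assumes "has_egradient f x u" "has_egradient f x v"
  shows "u = v"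
proof -
  have "(\<lambda>h. h \<bullet> u) = (\<lambda>h. h \<bullet> v)"
    using assms unfolding has_egradient_def gderiv_def by (rule has_derivative_unique)
  then have "(u - v) \<bullet> u = (u - v) \<bullet> v" by (rule fun_cong)
  then have "(u - v) \<bullet> (u - v) = 0" by (simp add: inner_diff_right)
  then show ?thesis by simp
qed

lemma has_egradient_egrad: "\<exists>v. has_egradient f x v \<Longrightarrow> has_egradient f x (egrad f x)"
  unfolding egrad_def by (rule theI') (use has_egradient_unique in blast)

section \<open>Legendre kernels\<close>

locale legendre_kernel =
  fixes h :: "'a::euclidean_space \<Rightarrow> ereal" and \<alpha> :: real
  assumes h_proper: "proper_fun h" and h_lsc: "lsc_fun h" and h_smooth: "essentially_smooth h"
    and h_strong: "strongly_econvex \<alpha> h" and \<alpha>_pos: "\<alpha> > 0"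
begin

definition H :: "'a \<Rightarrow> real" where "H x = real_of_ereal (h x)"

definition D :: "'a \<Rightarrow> 'a \<Rightarrow> real" where "D x y = H x - H y - egrad h y \<bullet> (x - y)"

lemma interior_edom: "x \<in> interior (edom h) \<Longrightarrow> x \<in> edom h"
  using interior_subset by blast

lemma bregman_eq_D: "x \<in> edom h \<Longrightarrow> y \<in> edom h \<Longrightarrow> bregman h x y = ereal (D x y)"
  using bregman_real[OF h_proper] by (simp add: D_def H_def)

lemma convex_edom_h: "convex (edom h)"
  unfolding convex_alt
proof (intro ballI allI impI)
  fix x y and u :: real assume *: "x \<in> edom h" "y \<in> edom h" "0 \<le> u \<and> u \<le> 1"
  then consider "u = 0" | "u = 1" | "0 < u" "u < 1" by linarith
  then show "(1 - u) *\<^sub>R x + u *\<^sub>R y \<in> edom h"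
    by cases (use * strongly_econvexD_real(1)[OF h_strong h_proper] in auto)
qed

lemma H_strong:
  "x \<in> edom h \<Longrightarrow> y \<in> edom h \<Longrightarrow> 0 < t \<Longrightarrow> t < 1 \<Longrightarrow>
    H ((1 - t) *\<^sub>R x + t *\<^sub>R y) + \<alpha> / 2 * t * (1 - t) * (norm (x - y))\<^sup>2 \<le> (1 - t) * H x + t * H y"
  unfolding H_def by (rule strongly_econvexD_real(2)[OF h_strong h_proper])

lemma H_derivative:
  assumes "x \<in> interior (edom h)"
  shows "(H has_derivative (\<lambda>v. v \<bullet> egrad h x)) (at x)"
proof -
  have "has_egradient h x (egrad h x)"
    using has_egradient_egrad[of h x] assms h_smooth by (simp add: essentially_smooth_def)
  then show ?thesis by (simp add: has_egradient_def gderiv_def H_def[abs_def])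
qed

lemma H_directional_derivative:
  assumes "x \<in> interior (edom h)"
  shows "((\<lambda>t. (H (x + t *\<^sub>R v) - H x) / t) \<longlongrightarrow> egrad h x \<bullet> v) (at_right 0)"
proof -
  have "((\<lambda>t. H (x + t *\<^sub>R v)) has_derivative (\<lambda>t. (t *\<^sub>R v) \<bullet> egrad h x)) (at 0)"
    by (rule has_derivative_compose[of _ "\<lambda>t. t *\<^sub>R v"])
       (use H_derivative[OF assms] in \<open>auto intro!: derivative_eq_intros\<close>)
  then have "((\<lambda>t. H (x + t *\<^sub>R v)) has_real_derivative (egrad h x \<bullet> v)) (at 0)"
    unfolding has_field_derivative_def
    by (rule has_derivative_eq_rhs) (auto simp: inner_commute mult.commute)
  then have "((\<lambda>t. (H (x + t *\<^sub>R v) - H x) / t) \<longlongrightarrow> egrad h x \<bullet> v) (at 0)"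
    by (simp add: DERIV_def)
  then show ?thesis by (rule tendsto_within_subset) auto
qed

text \<open>The strong convexity inequality on the segment from \<open>y\<close> to \<open>x\<close>
  bounds a difference quotient of \<open>H\<close> at \<open>y\<close>; letting the parameter
  decrease to 0 turns that quotient into the gradient term.\<close>

lemma D_ge:
  assumes x: "x \<in> edom h" and y: "y \<in> interior (edom h)"
  shows "\<alpha> / 2 * (norm (x - y))\<^sup>2 \<le> D x y"
proof -
  have "\<forall>\<^sub>F t in at_right 0. (H (y + t *\<^sub>R (x - y)) - H y) / t + \<alpha> / 2 * (1 - t) * (norm (x - y))\<^sup>2 \<le> H x - H y"
    using eventually_at_right_less[of 0] eventually_at_right_real[of 0 1, OF zero_less_one]
  proof eventually_elim
    case (elim t)
    then have t: "0 < t" "t < 1" by auto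
    have "H (y + t *\<^sub>R (x - y)) + \<alpha> / 2 * t * (1 - t) * (norm (x - y))\<^sup>2 \<le> (1 - t) * H y + t * H x"
      using H_strong[OF interior_edom[OF y] x t] by (simp add: algebra_simps norm_minus_commute)
    then have "H (y + t *\<^sub>R (x - y)) - H y \<le> t * (H x - H y - \<alpha> / 2 * (1 - t) * (norm (x - y))\<^sup>2)"
      by (simp add: algebra_simps)
    then have "(H (y + t *\<^sub>R (x - y)) - H y) / t \<le> H x - H y - \<alpha> / 2 * (1 - t) * (norm (x - y))\<^sup>2"
      using t by (simp add: pos_divide_le_eq mult.commute)
    then show ?case by simp
  qed
  then have "egrad h y \<bullet> (x - y) + \<alpha> / 2 * (1 - 0) * (norm (x - y))\<^sup>2 \<le> H x - H y"
    by (rule tendsto_upperbound[rotated])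
       (intro tendsto_intros H_directional_derivative y trivial_limit_at_right_real)+
  then show ?thesis by (simp add: D_def)
qed

lemma D_nonneg: "x \<in> edom h \<Longrightarrow> y \<in> interior (edom h) \<Longrightarrow> 0 \<le> D x y"
  using \<alpha>_pos by (intro order_trans[OF _ D_ge]) auto

text \<open>Converts the gradient differences in the optimality conditions into Bregman distances;
  the values of \<open>H\<close> cancel, so no domain condition enters.\<close>

lemma three_point: "(egrad h y - egrad h z) \<bullet> (x - y) = D x z - D x y - D y z"
  by (simp add: D_def algebra_simps)

lemma segment_interior:
  assumes "x \<in> edom h" "a \<in> interior (edom h)" "0 < t" "t \<le> 1"
  shows "x + t *\<^sub>R (a - x) \<in> interior (edom h)"
proof -
  have "x - t *\<^sub>R (x - a) \<in> interior (edom h)"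
    using assms closure_subset
    by (intro mem_interior_closure_convex_shrink convex_edom_h) auto
  then show ?thesis by (simp add: algebra_simps)
qed

text \<open>
  At a boundary point of the domain, essential smoothness makes the slope of \<open>H\<close> towards an interior
  point equal to minus infinity, which \<open>M\<close> excludes.
\<close>

lemma interior_edomI:
  assumes x: "x \<in> edom h" and a: "a \<in> interior (edom h)"
    and M: "\<And>t. 0 < t \<Longrightarrow> t < 1 \<Longrightarrow> H x \<le> H (x + t *\<^sub>R (a - x)) + t * M"
  shows "x \<in> interior (edom h)"
proof (rule ccontr)
  assume nx: "x \<notin> interior (edom h)"
  have "isCont H a" using has_derivative_continuous[OF H_derivative[OF a]] by simp
  then obtain \<delta> where \<delta>: "\<delta> > 0" "\<And>y. dist y a < \<delta> \<Longrightarrow> dist (H y) (H a) < 1"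
    unfolding continuous_at_eps_delta by (meson zero_less_one)
  obtain \<epsilon>' where \<epsilon>': "\<epsilon>' > 0" "cball a \<epsilon>' \<subseteq> interior (edom h)"
    using a open_contains_cball[of "interior (edom h)"] by auto
  define \<epsilon> where "\<epsilon> = min \<epsilon>' (\<delta> / 2)"
  have \<epsilon>: "\<epsilon> > 0" "\<epsilon> \<le> \<epsilon>'" "\<epsilon> < \<delta>" using \<delta>(1) \<epsilon>'(1) by (auto simp: \<epsilon>_def)
  define B where "B = 1 + \<bar>M\<bar> + norm (egrad h a) * norm (a - x)"
  \<comment> \<open>Gradients stay bounded along the segment: \<open>M\<close> bounds their
    component along \<open>a - x\<close> from below, and the point \<open>y\<close> near
    \<open>a\<close>, shifted in the direction of \<open>G\<close>, picks up the full norm of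
    \<open>G\<close> while \<open>H y - H z\<close> remains bounded.\<close>
  have bound: "\<epsilon> * norm (egrad h (x + t *\<^sub>R (a - x))) \<le> B" if t: "0 < t" "t < 1" for t
  proof -
    define z where "z = x + t *\<^sub>R (a - x)"
    define G where "G = egrad h z"
    have z: "z \<in> interior (edom h)" unfolding z_def using segment_interior[OF x a] t by simp
    have "0 \<le> D x z" by (rule D_nonneg[OF x z])
    then have "- (t * (G \<bullet> (a - x))) \<le> H x - H z"
      by (simp add: D_def G_def z_def)
    also have "\<dots> \<le> t * M" using M[OF t] by (simp add: z_def)
    finally have "t * (- M) \<le> t * (G \<bullet> (a - x))" by simp
    then have Glow: "- M \<le> G \<bullet> (a - x)" using t by (simp only: mult_le_cancel_left_pos)
    have "- \<bar>M\<bar> \<le> (1 - t) * (- \<bar>M\<bar>)" using t by (simp add: algebra_simps)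
    also have "\<dots> \<le> (1 - t) * (G \<bullet> (a - x))" using Glow t by (intro mult_left_mono) auto
    finally have 1: "- \<bar>M\<bar> \<le> (1 - t) * (G \<bullet> (a - x))" .
    define y where "y = a + \<epsilon> *\<^sub>R sgn G"
    have dy: "dist y a \<le> \<epsilon>" using \<epsilon>(1) by (simp add: y_def dist_norm norm_sgn)
    then have "y \<in> cball a \<epsilon>'" using \<epsilon>(2) by (simp add: dist_commute)
    then have y: "y \<in> edom h" using \<epsilon>' interior_edom by blast
    have "dist (H y) (H a) < 1" using dy \<epsilon> by (intro \<delta>) simp
    then have 2: "H y < H a + 1" by (simp add: dist_real_def)
    have "0 \<le> D y z" by (rule D_nonneg[OF y z])
    moreover have "G \<bullet> sgn G = norm G"
      by (cases "G = 0") (auto simp: sgn_div_norm dot_square_norm power2_eq_square)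
    moreover have "y - z = (1 - t) *\<^sub>R (a - x) + \<epsilon> *\<^sub>R sgn G"
      by (simp add: y_def z_def algebra_simps)
    ultimately have 3: "H z + (1 - t) * (G \<bullet> (a - x)) + \<epsilon> * norm G \<le> H y"
      by (simp add: D_def inner_add_right flip: G_def)
    have "0 \<le> D z a" by (rule D_nonneg[OF interior_edom[OF z] a])
    then have "H a + egrad h a \<bullet> (z - a) \<le> H z" by (simp add: D_def)
    moreover have "- (egrad h a \<bullet> (z - a)) \<le> norm (egrad h a) * norm (z - a)"
      using Cauchy_Schwarz_ineq2[of "egrad h a" "z - a"] by linarith
    moreover have "z - a = (1 - t) *\<^sub>R (x - a)" by (simp add: z_def algebra_simps)
    then have "norm (z - a) \<le> norm (a - x)"
      using t by (simp add: norm_minus_commute mult_left_le_one_le)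
    then have "norm (egrad h a) * norm (z - a) \<le> norm (egrad h a) * norm (a - x)"
      by (rule mult_left_mono) simp
    ultimately show ?thesis using 1 2 3 unfolding B_def G_def z_def by linarith
  qed
  \<comment> \<open>The offset 2 keeps the parameter strictly between 0 and 1, as
    \<open>bound\<close> requires.\<close>
  define u where "u n = x + (1 / real (n + 2)) *\<^sub>R (a - x)" for n :: nat
  have u: "u n \<in> interior (edom h)" for n
    unfolding u_def by (rule segment_interior[OF x a]) auto
  have "(\<lambda>n. 1 / real (n + 2)) \<longlonglongrightarrow> 0"
    by (rule LIMSEQ_ignore_initial_segment[OF lim_1_over_n])
  then have "u \<longlonglongrightarrow> x + 0 *\<^sub>R (a - x)" unfolding u_def by (intro tendsto_intros)
  then have lim: "u \<longlonglongrightarrow> x" by simp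
  then have "x \<in> closure (interior (edom h))" using u closure_sequential by blast
  then have "x \<in> frontier (interior (edom h))" using nx by (simp add: frontier_def)
  then have "filterlim (\<lambda>n. norm (egrad h (u n))) at_top sequentially"
    using h_smooth u lim unfolding essentially_smooth_def by blast
  then have "\<forall>\<^sub>F n in sequentially. B / \<epsilon> < norm (egrad h (u n))"
    by (simp add: filterlim_at_top_dense)
  then obtain n where "B / \<epsilon> < norm (egrad h (u n))" by (meson eventually_happens' sequentially_bot)
  then have "B < \<epsilon> * norm (egrad h (u n))" using \<epsilon>(1) by (simp add: pos_divide_less_eq mult.commute)
  moreover have "\<epsilon> * norm (egrad h (u n)) \<le> B" unfolding u_def by (rule bound) auto
  ultimately show False by simp
qed

section \<open>The proximal subproblem: existence, interiority and optimality of its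
  minimizers\<close>

definition prox_obj :: "('a \<Rightarrow> ereal) \<Rightarrow> real \<Rightarrow> 'a \<Rightarrow> real \<Rightarrow> 'a \<Rightarrow> ereal" where
  "prox_obj g \<kappa> u c v = g v + ereal \<kappa> * h v + ereal (u \<bullet> v + c)"

context
  fixes g :: "'a \<Rightarrow> ereal" and \<kappa> c :: real and u a :: 'a
  assumes g: "proper_fun g" "econvex g" "lsc_fun g" and \<kappa>: "\<kappa> > 0"
    and a: "a \<in> edom g" "a \<in> interior (edom h)"
begin

lemma prox_obj_edom: "edom (prox_obj g \<kappa> u c) = edom g \<inter> edom h"
proof -
  have "prox_obj g \<kappa> u c v < \<infinity> \<longleftrightarrow> g v < \<infinity> \<and> h v < \<infinity>" for v
    using g(1) h_proper \<kappa> by (cases "g v"; cases "h v") (auto simp: prox_obj_def proper_fun_def)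
  then show ?thesis by (auto simp: edom_def)
qed

lemma prox_obj_eq:
  "v \<in> edom g \<Longrightarrow> v \<in> edom h \<Longrightarrow>
    prox_obj g \<kappa> u c v = ereal (real_of_ereal (g v) + \<kappa> * H v + u \<bullet> v + c)"
  by (rule edomE[OF g(1)], assumption, rule edomE[OF h_proper], assumption)
     (simp add: prox_obj_def H_def)

lemma prox_obj_not_MInf: "prox_obj g \<kappa> u c v \<noteq> -\<infinity>"
  using g(1) h_proper \<kappa> by (cases "g v"; cases "h v") (auto simp: prox_obj_def proper_fun_def)

lemma prox_obj_proper: "proper_fun (prox_obj g \<kappa> u c)"
  unfolding proper_fun_def prox_obj_edom using prox_obj_not_MInf a interior_edom by blast

lemma prox_obj_lsc: "lsc_fun (prox_obj g \<kappa> u c)"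
proof -
  have "ereal \<kappa> * h v \<noteq> -\<infinity>" "g v + ereal \<kappa> * h v \<noteq> -\<infinity>" for v
    using g(1) h_proper \<kappa> by (cases "g v"; cases "h v"; auto simp: proper_fun_def)+
  moreover have "continuous_on UNIV (\<lambda>v. u \<bullet> v + c)" by (intro continuous_intros)
  ultimately show ?thesis using g(1) unfolding prox_obj_def[abs_def]
    by (intro lsc_fun_add lsc_fun_cmult lsc_fun_continuous g h_lsc \<kappa>) (auto simp: proper_fun_def)
qed

lemma prox_obj_strong: "strongly_econvex (\<kappa> * \<alpha>) (prox_obj g \<kappa> u c)"
  unfolding strongly_econvex_def
proof (intro allI impI)
  fix x y :: 'a and t :: real assume t: "0 < t \<and> t < 1"
  let ?f = "prox_obj g \<kappa> u c" and ?z = "(1 - t) *\<^sub>R x + t *\<^sub>R y"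
  show "?f ?z + ereal (\<kappa> * \<alpha> / 2 * t * (1 - t) * (norm (x - y))\<^sup>2) \<le> ereal (1 - t) * ?f x + ereal t * ?f y"
  proof (cases "x \<in> edom ?f \<and> y \<in> edom ?f")
    case False
    then have "?f x = \<infinity> \<or> ?f y = \<infinity>" by (auto simp: edom_def)
    then have "ereal (1 - t) * ?f x + ereal t * ?f y = \<infinity>"
      using t prox_obj_not_MInf[of x] prox_obj_not_MInf[of y]
      by (cases "?f x"; cases "?f y") auto
    then show ?thesis by (simp only: ereal_less_eq(1))
  next
    case True
    then have x: "x \<in> edom g" "x \<in> edom h" and y: "y \<in> edom g" "y \<in> edom h"
      by (auto simp: prox_obj_edom)
    define z where "z = ?z"
    have z: "z \<in> edom g" "z \<in> edom h"
      using econvexD_real(1)[OF g(2,1) x(1) y(1)] strongly_econvexD_real(1)[OF h_strong h_proper x(2) y(2)] t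
      by (auto simp: z_def)
    have "\<kappa> * (H z + \<alpha> / 2 * t * (1 - t) * (norm (x - y))\<^sup>2) \<le> \<kappa> * ((1 - t) * H x + t * H y)"
      using H_strong[OF x(2) y(2)] t \<kappa> unfolding z_def by (intro mult_left_mono) auto
    moreover have "real_of_ereal (g z) \<le> (1 - t) * real_of_ereal (g x) + t * real_of_ereal (g y)"
      using econvexD_real(2)[OF g(2,1) x(1) y(1)] t by (auto simp: z_def)
    moreover have "u \<bullet> z = (1 - t) * (u \<bullet> x) + t * (u \<bullet> y)" by (simp add: z_def inner_add_right)
    ultimately show ?thesis
      unfolding z_def[symmetric] by (simp add: prox_obj_eq x y z algebra_simps)
  qed
qed

lemma prox_obj_minimizer: "\<exists>x. is_arg_min (prox_obj g \<kappa> u c) (\<lambda>_. True) x"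
  using strongly_econvex_attains_inf[OF prox_obj_lsc prox_obj_proper prox_obj_strong] \<kappa> \<alpha>_pos
  by (auto simp: is_arg_min_def not_less)

text \<open>The minimizer is compared with points on segments leaving it, using only convexity of
  \<open>g\<close>. The segment towards \<open>a\<close> yields the slope bound of
  \<open>interior_edomI\<close>; after that, \<open>h\<close> is differentiable at the minimizer and
  the segment towards \<open>y\<close> yields the variational inequality.\<close>

lemma prox_obj_optimality:
  assumes min: "is_arg_min (prox_obj g \<kappa> u c) (\<lambda>_. True) x"
  shows "x \<in> edom g" "x \<in> interior (edom h)"
    and "y \<in> edom g \<Longrightarrow>
      0 \<le> real_of_ereal (g y) - real_of_ereal (g x) + (\<kappa> *\<^sub>R egrad h x + u) \<bullet> (y - x)"
proof -
  let ?f = "prox_obj g \<kappa> u c" and ?G = "\<lambda>v. real_of_ereal (g v)"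
  have le: "?f x \<le> ?f y" for y using min by (auto simp: is_arg_min_def not_less)
  have "?f a < \<infinity>" using a interior_edom prox_obj_edom by (auto simp: edom_def)
  then have "?f x < \<infinity>" using le[of a] by (rule le_less_trans[rotated])
  then have "x \<in> edom ?f" by (simp add: edom_def)
  then have x: "x \<in> edom g" "x \<in> edom h" by (auto simp: prox_obj_edom)
  then show "x \<in> edom g" by simp
  have key: "0 \<le> t * (?G y - ?G x) + \<kappa> * (H (x + t *\<^sub>R (y - x)) - H x) + t * (u \<bullet> (y - x))"
    if y: "y \<in> edom g" and t: "0 < t" "t < 1" and z: "x + t *\<^sub>R (y - x) \<in> edom h" for y t
  proof -
    have eq: "x + t *\<^sub>R (y - x) = (1 - t) *\<^sub>R x + t *\<^sub>R y" by (simp add: algebra_simps)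
    have zg: "x + t *\<^sub>R (y - x) \<in> edom g"
      unfolding eq by (rule econvexD_real(1)[OF g(2,1) x(1) y t])
    have "?G (x + t *\<^sub>R (y - x)) \<le> (1 - t) * ?G x + t * ?G y"
      unfolding eq by (rule econvexD_real(2)[OF g(2,1) x(1) y t])
    moreover have "?G x + \<kappa> * H x + u \<bullet> x + c
        \<le> ?G (x + t *\<^sub>R (y - x)) + \<kappa> * H (x + t *\<^sub>R (y - x)) + u \<bullet> (x + t *\<^sub>R (y - x)) + c"
      using le[of "x + t *\<^sub>R (y - x)"] by (simp only: prox_obj_eq[OF x] prox_obj_eq[OF zg z] ereal_less_eq)
    ultimately show ?thesis by (simp add: algebra_simps)
  qed
  show xi: "x \<in> interior (edom h)"
  proof (rule interior_edomI[OF x(2) a(2), of "(?G a - ?G x + u \<bullet> (a - x)) / \<kappa>"])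
    fix t :: real assume t: "0 < t" "t < 1"
    have "x + t *\<^sub>R (a - x) \<in> edom h"
      using segment_interior[OF x(2) a(2)] t interior_edom by simp
    from key[OF a(1) t this] have "\<kappa> * (H x - H (x + t *\<^sub>R (a - x))) \<le> t * (?G a - ?G x + u \<bullet> (a - x))"
      by (simp add: algebra_simps)
    then have "H x - H (x + t *\<^sub>R (a - x)) \<le> t * (?G a - ?G x + u \<bullet> (a - x)) / \<kappa>"
      using \<kappa> by (simp add: pos_le_divide_eq mult.commute)
    then show "H x \<le> H (x + t *\<^sub>R (a - x)) + t * ((?G a - ?G x + u \<bullet> (a - x)) / \<kappa>)" by simp
  qed
  show "0 \<le> ?G y - ?G x + (\<kappa> *\<^sub>R egrad h x + u) \<bullet> (y - x)" if y: "y \<in> edom g"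
  proof -
    \<comment> \<open>The point \<open>y\<close> may lie outside \<open>edom h\<close>, but
      \<open>x\<close> is interior, so short pieces of the segment stay inside.\<close>
    have "((\<lambda>t. x + t *\<^sub>R (y - x)) \<longlongrightarrow> x + 0 *\<^sub>R (y - x)) (at_right 0)"
      by (intro tendsto_intros)
    then have "\<forall>\<^sub>F t in at_right 0. x + t *\<^sub>R (y - x) \<in> interior (edom h)"
      by (rule topological_tendstoD) (use xi in auto)
    then have "\<forall>\<^sub>F t in at_right 0. 0 \<le> ?G y - ?G x + \<kappa> * ((H (x + t *\<^sub>R (y - x)) - H x) / t) + u \<bullet> (y - x)"
      using eventually_at_right_real[of 0 1, OF zero_less_one]
    proof eventually_elim
      case (elim t)
      then have t: "0 < t" "t < 1" by auto
      let ?d = "H (x + t *\<^sub>R (y - x)) - H x"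
      have "0 \<le> t * (?G y - ?G x) + \<kappa> * ?d + t * (u \<bullet> (y - x))"
        using key[OF y t] elim(1) interior_edom by blast
      also have "\<dots> = t * (?G y - ?G x + \<kappa> * (?d / t) + u \<bullet> (y - x))"
        using t by (simp add: field_simps)
      finally show ?case using t by (simp only: zero_le_mult_iff) linarith
    qed
    then have "0 \<le> ?G y - ?G x + \<kappa> * (egrad h x \<bullet> (y - x)) + u \<bullet> (y - x)"
      by (rule tendsto_lowerbound[rotated])
         (intro tendsto_intros H_directional_derivative xi trivial_limit_at_right_real)+
    then show ?thesis by (simp add: inner_add_left algebra_simps)
  qed
qed

end

text \<open>A minimizer of \<open>h\<close> minus the linear form of \<open>v\<close> exists, is
  interior, and has gradient \<open>v\<close>: testing optimality in the direction
  \<open>v - egrad h x\<close> leaves minus a squared norm that must be nonnegative.\<close>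

lemma egrad_surj: "egrad h ` interior (edom h) = UNIV"
proof -
  have "v \<in> egrad h ` interior (edom h)" for v
  proof -
    have "interior (edom h) \<noteq> {}" using h_smooth by (simp add: essentially_smooth_def)
    then obtain a where a: "a \<in> interior (edom h)" by blast
    have [simp]: "edom (\<lambda>_. 0) = UNIV" by (simp add: edom_def)
    have zero: "proper_fun (\<lambda>_::'a. 0)" "econvex (\<lambda>_::'a. 0)" "lsc_fun (\<lambda>_::'a. 0)"
      using lsc_fun_continuous[of "\<lambda>_. 0"] by (auto simp: proper_fun_def econvex_def edom_def simp flip: zero_ereal_def)
    note prox = zero zero_less_one[where 'a=real]
    obtain x where x: "is_arg_min (prox_obj (\<lambda>_. 0) 1 (- v) 0) (\<lambda>_. True) x"
      using prox_obj_minimizer[OF prox _ a] by auto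
    have "0 \<le> (egrad h x - v) \<bullet> ((v - egrad h x + x) - x)"
      using prox_obj_optimality(3)[OF prox _ a x, of "v - egrad h x + x"] by simp
    then have "(egrad h x - v) \<bullet> (egrad h x - v) \<le> 0"
      by (simp add: algebra_simps)
    then have "egrad h x = v"
      by (metis eq_iff_diff_eq_0 inner_gt_zero_iff not_less)
    then show ?thesis using prox_obj_optimality(2)[OF prox _ a x] by auto
  qed
  then show ?thesis by blast
qed

text \<open>The expression is constant in \<open>x\<close>: the coefficients of \<open>H x\<close>
  sum to zero and the gradient terms cancel by the averaging relation.\<close>

lemma average_identity:
  assumes "\<phi> *\<^sub>R egrad h z' = (\<phi> - 1) *\<^sub>R egrad h v + egrad h z"
  shows "(\<phi> - 1) * D x v + D x z - \<phi> * D x z' = (\<phi> - 1) * D y v + D y z - \<phi> * D y z'"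
proof -
  have *: "\<phi> * (egrad h z' \<bullet> u) = (\<phi> - 1) * (egrad h v \<bullet> u) + egrad h z \<bullet> u" for u
    using arg_cong[OF assms, of "\<lambda>e. e \<bullet> u"] by (simp add: inner_add_left)
  show ?thesis
    using *[of x] *[of y] by (simp add: D_def inner_diff_right algebra_simps)
qed

text \<open>Expanding the Bregman distance leaves a multiple of \<open>h\<close> plus an affine
  function of \<open>v\<close>, so the algorithm's minimization is an instance of
  \<open>prox_obj\<close>.\<close>

lemma bregman_step_obj:
  assumes "proper_fun g" "\<kappa> > 0" "y \<in> edom h"
  shows "ereal (s \<bullet> (v - z)) + g v + ereal \<kappa> * bregman h v y =
    prox_obj g \<kappa> (s - \<kappa> *\<^sub>R egrad h y) (- (s \<bullet> z) - \<kappa> * (H y - egrad h y \<bullet> y)) v"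
proof -
  obtain r where r: "h y = ereal r" using edomE[OF h_proper assms(3)] .
  have "g v \<noteq> -\<infinity>" "h v \<noteq> -\<infinity>" using assms(1) h_proper by (auto simp: proper_fun_def)
  then show ?thesis
    using assms(2) r by (cases "g v"; cases "h v")
      (simp_all add: prox_obj_def bregman_def H_def inner_diff_left inner_diff_right algebra_simps)
qed

text \<open>Young's inequality with weight \<open>s\<close>, followed by \<open>D_ge\<close> for
  both squared norms.\<close>

lemma inner_le_D:
  assumes "x \<in> edom h" "y \<in> interior (edom h)" "x' \<in> edom h" "y' \<in> interior (edom h)" "0 < s"
  shows "\<alpha> * (norm (x - y) * norm (x' - y')) \<le> s * D x y + D x' y' / s"
proof -
  have "0 \<le> (s * norm (x - y) - norm (x' - y'))\<^sup>2 / s" using assms by simp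
  also have "\<dots> = s * (norm (x - y))\<^sup>2 + (norm (x' - y'))\<^sup>2 / s - 2 * (norm (x - y) * norm (x' - y'))"
    using assms(5) by (simp add: power2_eq_square field_simps)
  finally have "norm (x - y) * norm (x' - y') \<le> (s * (norm (x - y))\<^sup>2 + (norm (x' - y'))\<^sup>2 / s) / 2"
    by simp
  then have "\<alpha> * (norm (x - y) * norm (x' - y')) \<le> \<alpha> * ((s * (norm (x - y))\<^sup>2 + (norm (x' - y'))\<^sup>2 / s) / 2)"
    using \<alpha>_pos by (intro mult_left_mono) auto
  also have "\<dots> = s * (\<alpha> / 2 * (norm (x - y))\<^sup>2) + (\<alpha> / 2 * (norm (x' - y'))\<^sup>2) / s"
    using assms(5) by (simp add: field_simps)
  also have "\<dots> \<le> s * D x y + D x' y' / s"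
    using assms(5) D_ge[OF assms(1,2)] D_ge[OF assms(3,4)]
    by (intro add_mono mult_left_mono divide_right_mono) auto
  finally show ?thesis .
qed

end

section \<open>Contraction of real sequences\<close>

lemma golden_ratio_facts:
  shows "golden_ratio * golden_ratio = golden_ratio + 1" "1 < golden_ratio" "golden_ratio < 2"
proof -
  have "sqrt 5 < sqrt 9" "sqrt 4 < sqrt (5::real)" by (simp_all only: real_sqrt_less_iff)
  moreover have "sqrt 9 = (3::real)" "sqrt 4 = (2::real)"
    using real_sqrt_abs[of 3] real_sqrt_abs[of 2] by simp_all
  ultimately have "sqrt 5 < (3::real)" "2 < sqrt (5::real)" by simp_all
  then show "1 < golden_ratio" "golden_ratio < 2" by (auto simp: golden_ratio_def)
  show "golden_ratio * golden_ratio = golden_ratio + 1"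
    by (simp add: golden_ratio_def field_simps)
qed

text \<open>Since \<open>V\<close> dominates squared distances, the rate is the square root of
  \<open>q\<close>. In the constant \<open>C\<close>, the term with \<open>c\<close> serves the
  indices from \<open>K\<close> on and the sum absorbs the finitely many earlier ones.\<close>

lemma R_linearly_convergentI:
  fixes x :: "nat \<Rightarrow> 'a::real_normed_vector"
  assumes q: "0 < q" "q < 1" and \<beta>: "\<beta> > 0"
    and V: "\<And>k. k \<ge> K \<Longrightarrow> V (Suc k) \<le> q * V k"
    and le: "\<And>k. k \<ge> K \<Longrightarrow> \<beta> * (norm (x k - p))\<^sup>2 \<le> V k"
  shows "R_linearly_convergent x p"
proof -
  define r where "r = sqrt q"
  have r: "0 < r" "r < 1" "r\<^sup>2 = q" using q by (auto simp: r_def)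
  have V_le: "V (K + j) \<le> q ^ j * V K" for j
  proof (induction j)
    case (Suc j)
    have "V (K + Suc j) \<le> q * V (K + j)" using V[of "K + j"] by simp
    also have "\<dots> \<le> q * (q ^ j * V K)" using Suc q by (intro mult_left_mono) auto
    finally show ?case by (simp add: mult_ac)
  qed simp
  have VK: "0 \<le> V K" using order_trans[OF _ le[of K]] \<beta> by simp
  define c where "c = sqrt (V K / \<beta>)"
  have c: "0 \<le> c" "c\<^sup>2 = V K / \<beta>" using VK \<beta> by (auto simp: c_def)
  define C where "C = 1 + c / r ^ K + (\<Sum>k<K. norm (x k - p) / r ^ k)"
  have sum: "0 \<le> (\<Sum>k<K. norm (x k - p) / r ^ k)" using r by (intro sum_nonneg) auto
  have cK: "0 \<le> c / r ^ K" using c r by auto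
  have "norm (x k - p) \<le> C * r ^ k" for k
  proof (cases "k < K")
    case True
    have "norm (x k - p) / r ^ k \<le> (\<Sum>k<K. norm (x k - p) / r ^ k)"
      using r True by (intro member_le_sum) auto
    then have "norm (x k - p) / r ^ k \<le> C" using cK by (simp add: C_def)
    then show ?thesis using r by (simp add: pos_divide_le_eq)
  next
    case False
    then obtain j where j: "k = K + j" by (metis le_add_diff_inverse not_less)
    have "\<beta> * (norm (x k - p))\<^sup>2 \<le> q ^ j * V K" using le[of k] V_le[of j] j by simp
    then have "(norm (x k - p))\<^sup>2 \<le> q ^ j * V K / \<beta>" using \<beta> by (simp add: pos_le_divide_eq mult.commute)
    also have "\<dots> = (r\<^sup>2) ^ j * c\<^sup>2" using c r by simp
    also have "\<dots> = (r ^ j * c)\<^sup>2"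
      by (simp add: power_mult_distrib mult.commute flip: power_mult)
    finally have "norm (x k - p) \<le> r ^ j * c" by (rule power2_le_imp_le) (use c r in auto)
    also have "\<dots> = c / r ^ K * r ^ k" using r by (simp add: j power_add)
    also have "\<dots> \<le> C * r ^ k" using sum r by (intro mult_right_mono) (auto simp: C_def)
    finally show ?thesis .
  qed
  moreover have "C > 0" using sum cK by (simp add: C_def)
  ultimately show ?thesis unfolding R_linearly_convergent_def using r by blast
qed

text \<open>Dividing \<open>lam\<close> by the accumulated growth factors \<open>P\<close> gives a
  decreasing sequence. As \<open>P\<close> is bounded by the exponential of the sum of
  \<open>\<gamma>\<close>, this sequence has a positive limit, so it cannot shrink by the factor
  \<open>r\<close> infinitely often.\<close>

lemma eventually_no_geometric_decrease:
  fixes lam \<gamma> :: "nat \<Rightarrow> real"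
  assumes \<gamma>: "\<And>k. 0 \<le> \<gamma> k" "summable \<gamma>" and r: "r < 1" and m: "m > 0"
    and low: "\<And>k. m \<le> lam k" and growth: "\<And>k. lam (Suc k) \<le> (1 + \<gamma> k) * lam k"
  shows "\<forall>\<^sub>F k in sequentially. r * lam k < lam (Suc k)"
proof -
  define P where "P k = (\<Prod>j<k. 1 + \<gamma> j)" for k
  define \<nu> where "\<nu> k = lam k / P k" for k
  have P: "P k > 0" for k unfolding P_def using \<gamma>(1) by (intro prod_pos) (auto intro: add_pos_nonneg)
  have PS: "P (Suc k) = (1 + \<gamma> k) * P k" for k by (simp add: P_def mult.commute)
  have "P k \<le> exp (\<Sum>j<k. \<gamma> j)" for k
    unfolding P_def exp_sum[OF finite_lessThan] using \<gamma>(1) by (intro prod_mono) (auto intro: add_nonneg_nonneg)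
  also have "exp (\<Sum>j<k. \<gamma> j) \<le> exp (suminf \<gamma>)" for k
    using sum_le_suminf[OF \<gamma>(2)] \<gamma>(1) by simp
  finally have PM: "P k \<le> exp (suminf \<gamma>)" for k .
  have lam: "lam k > 0" for k using low[of k] m by simp
  have \<nu>_low: "m / exp (suminf \<gamma>) \<le> \<nu> k" for k
    unfolding \<nu>_def using PM[of k] P[of k] low[of k] lam[of k] by (intro frac_le) auto
  have dec: "decseq \<nu>"
  proof (rule decseq_SucI)
    fix k
    have "\<nu> (Suc k) \<le> (1 + \<gamma> k) * lam k / P (Suc k)"
      unfolding \<nu>_def using growth[of k] P[of "Suc k"] by (intro divide_right_mono) auto
    also have "\<dots> = \<nu> k" using \<gamma>(1)[of k] by (simp add: \<nu>_def PS)
    finally show "\<nu> (Suc k) \<le> \<nu> k" .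
  qed
  obtain l where l: "\<nu> \<longlonglongrightarrow> l" using decseq_convergent[OF dec] \<nu>_low by metis
  have "m / exp (suminf \<gamma>) \<le> l" by (rule LIMSEQ_le_const[OF l]) (use \<nu>_low in auto)
  moreover have "0 < m / exp (suminf \<gamma>)" using m by simp
  ultimately have "0 < l" by linarith
  then have "r * l < l" using r by simp
  have "(\<lambda>k. \<nu> (Suc k) - r * \<nu> k) \<longlonglongrightarrow> l - r * l" by (intro tendsto_intros LIMSEQ_Suc l)
  then have "\<forall>\<^sub>F k in sequentially. 0 < \<nu> (Suc k) - r * \<nu> k"
    by (rule order_tendstoD) (use \<open>r * l < l\<close> in simp)
  then show ?thesis
  proof eventually_elim
    case (elim k)
    \<comment> \<open>\<open>P\<close> is nondecreasing, so undoing the normalization only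
      helps.\<close>
    have "\<nu> (Suc k) \<le> lam (Suc k) / P k"
      unfolding \<nu>_def using P[of k] lam[of "Suc k"] \<gamma>(1)[of k] by (intro divide_left_mono) (auto simp: PS)
    then have "r * lam k / P k < lam (Suc k) / P k" using elim by (simp add: \<nu>_def)
    then show ?case using P[of k] by (simp add: divide_less_cancel)
  qed
qed

text \<open>
  Applied with \<open>a\<^sub>k = D p wbar\<^sub>k\<close>, \<open>b\<^sub>k = D w\<^sub>k wbar\<^sub>k\<close>, \<open>c\<^sub>k = D w\<^sub>k wbar\<^sub>k\<^sub>-\<^sub>1\<close>,
  \<open>d\<^sub>k = D w\<^sub>k w\<^sub>k\<^sub>-\<^sub>1\<close>, \<open>e\<^sub>k = D p w\<^sub>k\<close>.
\<close>

lemma golden_ratio_contraction: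
  fixes a b c d e \<gamma> :: "nat \<Rightarrow> real" and \<phi> \<eta> \<mu> :: real
  assumes \<phi>: "\<phi> * \<phi> = \<phi> + 1" "1 < \<phi>" and \<eta>: "0 < \<eta>" "\<eta> < \<phi> / 2" "\<eta> < 1" and \<mu>: "0 < \<mu>"
    and nonneg: "\<And>k. 0 \<le> a k" "\<And>k. 0 \<le> b k" "\<And>k. 0 \<le> c k" "\<And>k. 0 \<le> d k" "\<And>k. 0 \<le> e k" "\<And>k. 0 \<le> \<gamma> k"
    and small: "\<And>k. k \<ge> K \<Longrightarrow> \<phi> * \<gamma> k \<le> 1 - 1 / \<phi>" "\<And>k. k \<ge> K \<Longrightarrow> (1 + \<gamma> k) * \<eta> \<le> \<phi> / 2"
    and avg: "\<And>k. k \<ge> K \<Longrightarrow> e (Suc k) = (\<phi> + 1) * a (Suc k) - \<phi> * a k + \<phi> * c (Suc k) - (\<phi> + 1) * b (Suc k)"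
    and bc: "\<And>k. k \<ge> K \<Longrightarrow> (\<phi> + 1) * b (Suc k) \<le> \<phi> * c (Suc k)"
    and descent: "\<And>k. k \<ge> K \<Longrightarrow> e (Suc k) \<le> a k - c (Suc k) + \<phi> * (1 + \<gamma> k) * (c (Suc k) - d (Suc k) - b k)
        + (1 + \<gamma> k) * \<eta> * (d (Suc k) + d k) - \<mu> * e k"
    and low: "\<And>k. k \<ge> K \<Longrightarrow> e (Suc k) \<le> a k - c (Suc k) + \<eta> * (d (Suc k) / \<phi> + \<phi> * e (Suc k))"
  shows "\<exists>q W \<epsilon>. 0 < q \<and> q < 1 \<and> 0 < \<epsilon> \<and> (\<forall>k>K. W (Suc k) \<le> q * W k \<and> \<epsilon> * a k \<le> W k \<and> \<epsilon> * e k \<le> W k)"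
proof -
  \<comment> \<open>Nonnegativity of this Lyapunov function is not obvious; it comes from \<open>low\<close>, see \<open>V_low\<close>.\<close>
  define V where "V k = (\<phi> + 1) * a k - \<phi> * b k + (\<phi> - \<eta>) * d k" for k
  have inv: "1 / \<phi> = \<phi> - 1" using \<phi> by (simp add: field_simps)
  \<comment> \<open>This is \<open>bc\<close> divided by \<open>\<phi> + 1\<close>, since
    \<open>\<phi> / (\<phi> + 1) = 1 / \<phi> = \<phi> - 1\<close>.\<close>
  have b_le: "b (Suc k) \<le> (\<phi> - 1) * c (Suc k)" if "k \<ge> K" for k
  proof -
    have "(\<phi> - 1) * ((\<phi> + 1) * b (Suc k)) \<le> (\<phi> - 1) * (\<phi> * c (Suc k))"
      using bc[OF that] \<phi> by (intro mult_left_mono) auto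
    moreover have "(\<phi> - 1) * ((\<phi> + 1) * b (Suc k)) = (\<phi> * \<phi> - 1) * b (Suc k)" by (simp add: algebra_simps)
    ultimately have "\<phi> * b (Suc k) \<le> \<phi> * ((\<phi> - 1) * c (Suc k))" by (simp add: \<phi>(1) mult_ac)
    then show ?thesis using \<phi> by (simp only: mult_le_cancel_left_pos)
  qed
  \<comment> \<open>Eliminate \<open>e (Suc k)\<close> between \<open>avg\<close> and
    \<open>descent\<close>. After \<open>b_le\<close>, the coefficient of \<open>c (Suc k)\<close>
    is \<open>\<phi> * \<gamma> k - (2 - \<phi>)\<close>, nonpositive by \<open>small(1)\<close> as
    \<open>1 - 1 / \<phi> = 2 - \<phi>\<close>; \<open>small(2)\<close> bounds the coefficient of
    \<open>d k\<close> by \<open>\<phi> / 2\<close>.\<close>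
  have V_step: "V (Suc k) \<le> V k - (\<phi> / 2 - \<eta>) * d k - \<mu> * e k" if k: "k \<ge> K" for k
  proof -
    have "(1 + \<gamma> k) * \<eta> * d k \<le> \<phi> / 2 * d k" using small(2)[OF k] nonneg by (intro mult_right_mono) auto
    moreover have "0 \<le> \<gamma> k * (\<phi> - \<eta>) * d (Suc k)" using nonneg \<eta> \<phi> by simp
    moreover have "0 \<le> \<phi> * \<gamma> k * b k" using nonneg \<phi> by simp
    moreover have "\<phi> * \<gamma> k * c (Suc k) \<le> (2 - \<phi>) * c (Suc k)"
      using small(1)[OF k] nonneg unfolding inv by (intro mult_right_mono) auto
    ultimately show ?thesis
      using avg[OF k] descent[OF k] b_le[OF k] by (simp add: V_def algebra_simps)
  qed
  \<comment> \<open>By \<open>avg\<close>, \<open>V (Suc k)\<close> is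
    \<open>e (Suc k) + \<phi> * (a k - c (Suc k))\<close> plus \<open>b (Suc k)\<close> and a
    multiple of \<open>d (Suc k)\<close>; \<open>low\<close> bounds the difference from below, and
    \<open>\<eta> < \<phi> / 2\<close> keeps the remaining multiple of \<open>d (Suc k)\<close>
    nonnegative.\<close>
  have V_low: "(\<phi> + 1) * (1 - \<eta>) * e (Suc k) \<le> V (Suc k)" if k: "k \<ge> K" for k
  proof -
    have "\<phi> * e (Suc k) \<le> \<phi> * (a k - c (Suc k) + \<eta> * (d (Suc k) / \<phi> + \<phi> * e (Suc k)))"
      using low[OF k] \<phi> by (intro mult_left_mono) auto
    also have "\<dots> = \<phi> * (a k - c (Suc k)) + \<eta> * d (Suc k) + \<eta> * (\<phi> * \<phi>) * e (Suc k)"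
      using \<phi>(2) by (simp add: field_simps)
    finally have "\<phi> * e (Suc k) \<le> \<phi> * (a k - c (Suc k)) + \<eta> * d (Suc k) + \<eta> * (\<phi> + 1) * e (Suc k)"
      by (simp add: \<phi>(1))
    moreover have "0 \<le> (\<phi> - 2 * \<eta>) * d (Suc k)" using nonneg \<eta> by simp
    ultimately show ?thesis using eq_refl[OF avg[OF k]] nonneg(2)[of "Suc k"] by (simp add: V_def algebra_simps)
  qed
  \<comment> \<open>The first entry lets the decrease \<open>\<mu> * e k\<close> absorb the
    subtracted term of \<open>W\<close> in \<open>W_step\<close>; the second lets half of the bound
    \<open>V_low\<close> absorb it in \<open>W_low\<close>.\<close>
  define \<epsilon> where "\<epsilon> = min (\<mu> * (\<phi> + 1)) ((\<phi> + 1)\<^sup>2 * (1 - \<eta>) / 2)"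
  have \<epsilon>: "0 < \<epsilon>" "\<epsilon> / (\<phi> + 1) \<le> \<mu>" "\<epsilon> / (\<phi> + 1) \<le> (\<phi> + 1) * (1 - \<eta>) / 2"
    using \<phi> \<mu> \<eta> by (auto simp: \<epsilon>_def pos_divide_le_eq power2_eq_square min_le_iff_disj mult_ac)
  \<comment> \<open>The first entry pays for \<open>\<tau> * \<phi> * d k\<close> out of the
    decrease of \<open>V\<close>. The second pays for \<open>\<tau> * (\<phi> + 1) * a k\<close> out
    of the contraction of \<open>a\<close> by \<open>\<phi> - 1\<close>; it is positive because
    \<open>\<phi> < 2\<close>.\<close>
  define \<tau> where "\<tau> = min ((\<phi> / 2 - \<eta>) / \<phi>) (\<epsilon> * (2 - \<phi>) / (\<phi> + 1 + \<epsilon>))"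
  have "\<phi> < 2"
  proof (rule ccontr)
    assume "\<not> \<phi> < 2"
    then have "2 * \<phi> \<le> \<phi> * \<phi>" using \<phi> by (intro mult_right_mono) auto
    then show False using \<phi> \<open>\<not> \<phi> < 2\<close> by simp
  qed
  have \<tau>_le1: "\<tau> * \<phi> \<le> \<phi> / 2 - \<eta>"
    using \<phi> by (simp add: \<tau>_def flip: pos_le_divide_eq)
  have "\<tau> * (\<phi> + 1 + \<epsilon>) \<le> \<epsilon> * (2 - \<phi>)"
    using \<phi> \<epsilon> by (simp add: \<tau>_def flip: pos_le_divide_eq)
  then have \<tau>_le2: "\<tau> * (\<phi> + 1) \<le> \<epsilon> * (2 - \<phi> - \<tau>)" by (simp add: algebra_simps)
  have \<tau>_pos: "0 < \<tau>" using \<phi> \<eta> \<epsilon> \<open>\<phi> < 2\<close> by (simp add: \<tau>_def)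
  have "\<tau> * \<phi> < 1 * \<phi>" using \<tau>_le1 \<eta> \<phi> by linarith
  then have \<tau>_less: "\<tau> < 1" using \<phi> by simp
  \<comment> \<open>\<open>V\<close> does not bound its own decrease, since that decrease does not see \<open>a\<close>; but \<open>avg\<close> and
    \<open>bc\<close> contract \<open>a\<close> by the factor \<open>1 / \<phi>\<close> up to a multiple of \<open>e\<close>.\<close>
  define W where "W k = V k + \<epsilon> * (a k - e k / (\<phi> + 1))" for k
  define \<epsilon>' where "\<epsilon>' = min \<epsilon> ((\<phi> + 1) * (1 - \<eta>) / 2)"
  have W_step: "W (Suc k) \<le> (1 - \<tau>) * W k" if k: "k \<ge> K" for k
  proof -
    have "(\<phi> + 1) * a (Suc k) - e (Suc k) \<le> \<phi> * a k" using avg[OF k] bc[OF k] by linarith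
    also have "\<dots> = (\<phi> * \<phi> - 1) * a k" by (simp add: \<phi>(1))
    also have "\<dots> = (\<phi> + 1) * ((\<phi> - 1) * a k)" by (simp add: algebra_simps)
    finally have "a (Suc k) - e (Suc k) / (\<phi> + 1) \<le> (\<phi> - 1) * a k"
      using \<phi> by (simp add: field_simps)
    then have 1: "\<epsilon> * (a (Suc k) - e (Suc k) / (\<phi> + 1)) \<le> \<epsilon> * ((\<phi> - 1) * a k)"
      using \<epsilon> by (intro mult_left_mono) auto
    have "V k \<le> (\<phi> + 1) * a k + \<phi> * d k"
      using nonneg(2,4)[of k] \<phi> \<eta> by (simp add: V_def algebra_simps)
    then have "\<tau> * V k \<le> \<tau> * ((\<phi> + 1) * a k + \<phi> * d k)" using \<tau>_pos by (intro mult_left_mono) auto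
    moreover have "\<tau> * (\<phi> + 1) * a k \<le> \<epsilon> * (2 - \<phi> - \<tau>) * a k"
      using \<tau>_le2 nonneg by (intro mult_right_mono) auto
    moreover have "\<tau> * \<phi> * d k \<le> (\<phi> / 2 - \<eta>) * d k"
      using \<tau>_le1 nonneg by (intro mult_right_mono) auto
    moreover have "(1 - \<tau>) * (\<epsilon> / (\<phi> + 1)) \<le> 1 * \<mu>"
      using \<epsilon> \<tau>_pos \<tau>_less \<phi> \<mu> by (intro mult_mono) auto
    then have "(1 - \<tau>) * (\<epsilon> / (\<phi> + 1)) * e k \<le> \<mu> * e k"
      using nonneg by (intro mult_right_mono) auto
    ultimately show ?thesis using V_step[OF k] 1 by (simp add: W_def algebra_simps)
  qed
  have W_low: "\<epsilon> * a (Suc k) + (\<phi> + 1) * (1 - \<eta>) / 2 * e (Suc k) \<le> W (Suc k)" if k: "k \<ge> K" for k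
  proof -
    have "\<epsilon> / (\<phi> + 1) * e (Suc k) \<le> (\<phi> + 1) * (1 - \<eta>) / 2 * e (Suc k)"
      using \<epsilon>(3) nonneg by (intro mult_right_mono) auto
    moreover have "\<epsilon> * (a (Suc k) - e (Suc k) / (\<phi> + 1)) = \<epsilon> * a (Suc k) - \<epsilon> / (\<phi> + 1) * e (Suc k)"
      by (simp add: right_diff_distrib)
    moreover have "(\<phi> + 1) * (1 - \<eta>) * e (Suc k) = 2 * ((\<phi> + 1) * (1 - \<eta>) / 2 * e (Suc k))"
      by simp
    ultimately show ?thesis using V_low[OF k] unfolding W_def by linarith
  qed
  have \<epsilon>': "0 < \<epsilon>'" "\<epsilon>' \<le> \<epsilon>" "\<epsilon>' \<le> (\<phi> + 1) * (1 - \<eta>) / 2" using \<epsilon> \<eta> \<phi> by (auto simp: \<epsilon>'_def)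
  have "\<epsilon>' * a k \<le> W k \<and> \<epsilon>' * e k \<le> W k" if kK: "k > K" for k
  proof -
    obtain j where j: "k = Suc j" "j \<ge> K" using kK by (cases k) auto
    have "\<epsilon>' * a k \<le> \<epsilon> * a k" "\<epsilon>' * e k \<le> (\<phi> + 1) * (1 - \<eta>) / 2 * e k"
      by (rule mult_right_mono[OF \<epsilon>'(2) nonneg(1)], rule mult_right_mono[OF \<epsilon>'(3) nonneg(5)])
    moreover have "0 \<le> \<epsilon>' * a k" "0 \<le> \<epsilon>' * e k" using \<epsilon>' nonneg by auto
    ultimately show ?thesis using W_low[OF j(2), folded j(1)] by (intro conjI) linarith+
  qed
  then show ?thesis
    using W_step \<epsilon>'(1) \<tau>_pos \<tau>_less by (intro exI[of _ "1 - \<tau>"] exI[of _ W] exI[of _ \<epsilon>']) auto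
qed

section \<open>The iterates\<close>

locale bgraal_run = legendre_kernel h \<alpha>
  for h :: "'a::euclidean_space \<Rightarrow> ereal" and \<alpha> :: real +
  fixes A :: "'a \<Rightarrow> 'a" and g :: "'a \<Rightarrow> ereal" and L \<sigma> \<eta>0 \<eta>1 :: real
    and \<gamma> lam :: "nat \<Rightarrow> real" and w wbar :: "nat \<Rightarrow> 'a"
  assumes g: "proper_fun g" "econvex g" "lsc_fun g"
    and lipschitz: "L-lipschitz_on (edom g \<inter> interior (edom h)) A"
    and dom_inter: "edom g \<inter> interior (edom h) \<noteq> {}"
    and \<sigma>_pos: "\<sigma> > 0"
    and relative_strong: "\<And>z v. z \<in> edom h \<Longrightarrow> v \<in> interior (edom h) \<Longrightarrow>
      ereal \<sigma> * bregman h z v \<le> ereal ((A z - A v) \<bullet> (z - v))"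
    and algorithm: "modified_bgraal A g h \<alpha> \<eta>0 \<eta>1 \<gamma> lam w wbar"
begin

abbreviation \<phi> :: real where "\<phi> \<equiv> golden_ratio"

definition G :: "'a \<Rightarrow> real" where "G x = real_of_ereal (g x)"

section \<open>Positivity and growth of the step sizes\<close>

lemma parameters: "0 < lam 0" "0 < \<eta>1" "\<eta>1 < \<eta>0" "\<eta>0 < \<phi> / 2" "0 < \<gamma> k" "summable \<gamma>"
  using algorithm by (auto simp: modified_bgraal_def)

lemma lam_Suc:
  "lam (Suc k) =
    (if norm (A (w (Suc k)) - A (w k)) > \<eta>0 * \<alpha> / lam k * norm (w (Suc k) - w k)
     then \<eta>1 * \<alpha> * (norm (w (Suc k) - w k) / norm (A (w (Suc k)) - A (w k)))
     else (1 + \<gamma> k) * lam k)"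
proof -
  have "\<forall>k\<ge>1. lam k =
      (if norm (A (w k) - A (w (k - 1))) > \<eta>0 * \<alpha> / lam (k - 1) * norm (w k - w (k - 1))
       then \<eta>1 * \<alpha> * (norm (w k - w (k - 1)) / norm (A (w k) - A (w (k - 1))))
       else (1 + \<gamma> (k - 1)) * lam (k - 1))"
    using algorithm unfolding modified_bgraal_def by blast
  from this[rule_format, of "Suc k"] show ?thesis by simp
qed

lemma lam_pos: "0 < lam k"
proof (induction k)
  case (Suc k)
  show ?case
  proof (cases "norm (A (w (Suc k)) - A (w k)) > \<eta>0 * \<alpha> / lam k * norm (w (Suc k) - w k)")
    case True
    moreover have "0 \<le> \<eta>0 * \<alpha> / lam k * norm (w (Suc k) - w k)"
      using Suc \<alpha>_pos parameters(2,3) by (intro mult_nonneg_nonneg divide_nonneg_pos) auto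
    \<comment> \<open>The strict test in Step 1 excludes a zero denominator, and then the two
      iterates differ as well.\<close>
    ultimately have "0 < norm (A (w (Suc k)) - A (w k))" by (rule le_less_trans[rotated])
    moreover from this have "w (Suc k) \<noteq> w k" by auto
    ultimately show ?thesis
      using True lam_Suc[of k] parameters(2) \<alpha>_pos by simp
  next
    case False
    then show ?thesis using Suc lam_Suc[of k] parameters(5)[of k] by simp
  qed
qed (rule parameters)

text \<open>In the reduction branch the new step size is at most \<open>\<eta>1 / \<eta>0\<close>
  times the old one, so any larger ratio certifies that the other branch was taken.\<close>

lemma lam_Suc_le: "lam (Suc k) \<le> (1 + \<gamma> k) * lam k"
  and adaptive_step: "\<eta>1 / \<eta>0 * lam k < lam (Suc k) \<Longrightarrow>
    lam (Suc k) = (1 + \<gamma> k) * lam k \<and>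
    lam k * norm (A (w (Suc k)) - A (w k)) \<le> \<eta>0 * \<alpha> * norm (w (Suc k) - w k)"
proof -
  have \<eta>0: "0 < \<eta>0" using parameters by linarith
  let ?d = "norm (w (Suc k) - w k)" and ?D = "norm (A (w (Suc k)) - A (w k))"
  have "lam (Suc k) \<le> \<eta>1 / \<eta>0 * lam k" if "?D > \<eta>0 * \<alpha> / lam k * ?d"
  proof -
    have "0 \<le> \<eta>0 * \<alpha> / lam k * ?d"
      using lam_pos[of k] \<alpha>_pos \<eta>0 by (intro mult_nonneg_nonneg divide_nonneg_pos) auto
    then have D: "0 < ?D" using that by (rule le_less_trans)
    have "\<eta>0 * \<alpha> * ?d < lam k * ?D" using that lam_pos[of k] by (simp add: field_simps)
    then have "\<eta>1 / \<eta>0 * (\<eta>0 * \<alpha> * ?d) \<le> \<eta>1 / \<eta>0 * (lam k * ?D)"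
      using \<eta>0 parameters(2) by (intro mult_left_mono) auto
    then have "\<eta>1 * \<alpha> * ?d \<le> \<eta>1 / \<eta>0 * lam k * ?D" using \<eta>0 by simp
    then show ?thesis using that D by (simp add: lam_Suc pos_divide_le_eq)
  qed
  note case1 = this
  have "\<eta>1 / \<eta>0 * lam k \<le> 1 * lam k"
    using \<eta>0 parameters(3) lam_pos[of k] by (intro mult_right_mono) auto
  also have "\<dots> \<le> (1 + \<gamma> k) * lam k"
    using parameters(5)[of k] lam_pos[of k] by (intro mult_right_mono) auto
  finally show "lam (Suc k) \<le> (1 + \<gamma> k) * lam k"
    using case1 by (cases "?D > \<eta>0 * \<alpha> / lam k * ?d") (auto simp: lam_Suc)
  assume *: "\<eta>1 / \<eta>0 * lam k < lam (Suc k)"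
  then have le: "?D \<le> \<eta>0 * \<alpha> / lam k * ?d" using case1 by linarith
  then have "lam k * ?D \<le> \<eta>0 * \<alpha> * ?d" using lam_pos[of k] by (simp add: field_simps)
  with le show "lam (Suc k) = (1 + \<gamma> k) * lam k \<and> lam k * ?D \<le> \<eta>0 * \<alpha> * ?d"
    using lam_Suc[of k] by simp
qed

text \<open>By \<open>egrad_surj\<close>, \<open>inv_into\<close> returns a genuine preimage in the
  interior at every index from 1 on.\<close>

lemma wbar_interior: "wbar k \<in> interior (edom h)"
  and wbar_Suc: "\<phi> *\<^sub>R egrad h (wbar (Suc k)) = (\<phi> - 1) *\<^sub>R egrad h (w (Suc k)) + egrad h (wbar k)"
proof -
  let ?v = "\<lambda>k. (1 / \<phi>) *\<^sub>R ((\<phi> - 1) *\<^sub>R egrad h (w k) + egrad h (wbar (k - 1)))"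
  have eq: "wbar k = inv_into (interior (edom h)) (egrad h) (?v k)" if "k \<ge> 1" for k
    using algorithm that unfolding modified_bgraal_def by blast
  show "wbar k \<in> interior (edom h)"
  proof (cases k)
    case 0
    then show ?thesis using algorithm by (simp add: modified_bgraal_def)
  next
    case (Suc j)
    then show ?thesis using eq[of k] egrad_surj by (simp add: inv_into_into)
  qed
  have "egrad h (wbar (Suc k)) = ?v (Suc k)"
    using eq[of "Suc k"] egrad_surj by (simp add: f_inv_into_f)
  then show "\<phi> *\<^sub>R egrad h (wbar (Suc k)) = (\<phi> - 1) *\<^sub>R egrad h (w (Suc k)) + egrad h (wbar k)"
    using golden_ratio_facts(2) by simp
qed

text \<open>A minimizer exists, so \<open>arg_min\<close> really selects one; the conditions of
  \<open>prox_obj_optimality\<close> with \<open>\<kappa> = 1 / lam k\<close> are then multiplied by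
  \<open>lam k\<close>.\<close>

lemma step_optimality:
  assumes k: "k \<ge> 1"
  shows "w (Suc k) \<in> edom g" "w (Suc k) \<in> interior (edom h)"
    and "y \<in> edom g \<Longrightarrow> 0 \<le> lam k * (A (w k) \<bullet> (y - w (Suc k)) + G y - G (w (Suc k)))
      + (egrad h (w (Suc k)) - egrad h (wbar k)) \<bullet> (y - w (Suc k))"
proof -
  obtain a where a: "a \<in> edom g" "a \<in> interior (edom h)" using dom_inter by blast
  define \<kappa> where "\<kappa> = 1 / lam k"
  have \<kappa>: "\<kappa> > 0" using lam_pos[of k] by (simp add: \<kappa>_def)
  let ?u = "A (w k) - \<kappa> *\<^sub>R egrad h (wbar k)"
  let ?c = "- (A (w k) \<bullet> w k) - \<kappa> * (H (wbar k) - egrad h (wbar k) \<bullet> wbar k)"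
  have "w (k + 1) = arg_min
      (\<lambda>v. ereal (A (w k) \<bullet> (v - w k)) + g v + ereal (1 / lam k) * bregman h v (wbar k)) (\<lambda>_. True)"
    using algorithm k unfolding modified_bgraal_def by blast
  then have "w (Suc k) = arg_min (prox_obj g \<kappa> ?u ?c) (\<lambda>_. True)"
    unfolding \<kappa>_def[symmetric] bregman_step_obj[OF g(1) \<kappa> interior_edom[OF wbar_interior]]
    by simp
  then have min: "is_arg_min (prox_obj g \<kappa> ?u ?c) (\<lambda>_. True) (w (Suc k))"
    unfolding arg_min_def using someI_ex[OF prox_obj_minimizer[OF g \<kappa> a]] by simp
  note opt = prox_obj_optimality[OF g \<kappa> a min]
  show "w (Suc k) \<in> edom g" "w (Suc k) \<in> interior (edom h)" by (rule opt)+
  assume "y \<in> edom g"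
  from opt(3)[OF this]
  have "0 \<le> lam k * (G y - G (w (Suc k)) + (\<kappa> *\<^sub>R egrad h (w (Suc k)) + ?u) \<bullet> (y - w (Suc k)))"
    using lam_pos[of k] by (simp add: G_def)
  also have "\<dots> = lam k * (A (w k) \<bullet> (y - w (Suc k)) + G y - G (w (Suc k)))
      + (lam k * \<kappa>) * ((egrad h (w (Suc k)) - egrad h (wbar k)) \<bullet> (y - w (Suc k)))"
    by (simp add: inner_add_left inner_diff_left algebra_simps)
  finally show "0 \<le> lam k * (A (w k) \<bullet> (y - w (Suc k)) + G y - G (w (Suc k)))
      + (egrad h (w (Suc k)) - egrad h (wbar k)) \<bullet> (y - w (Suc k))"
    using lam_pos[of k] by (simp add: \<kappa>_def)
qed

lemma w_interior: "w k \<in> interior (edom h)"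
proof -
  consider "k = 0" | "k = 1" | j where "k = Suc j" "j \<ge> 1"
    by (metis One_nat_def Suc_leI not0_implies_Suc not_gr_zero)
  then show ?thesis
    by cases (use algorithm step_optimality(2) in \<open>auto simp: modified_bgraal_def\<close>)
qed

lemma w_edom_g: "k \<ge> 2 \<Longrightarrow> w k \<in> edom g"
  using step_optimality(1)[of "k - 1"] by (cases k) auto

text \<open>Only the reduction branch can lower the step size, and there the Lipschitz bound limits
  the damage. That bound needs both iterates in \<open>edom g\<close>, which is guaranteed from
  index 2 on.\<close>

lemma lam_lower_bound: "\<exists>m>0. \<forall>k\<ge>2. m \<le> lam k"
proof -
  have L: "0 \<le> L" using lipschitz by (rule lipschitz_on_nonneg)
  \<comment> \<open>Using \<open>L + 1\<close> instead of \<open>L\<close> keeps the quotient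
    meaningful for \<open>L = 0\<close>.\<close>
  define m where "m = min (lam 2) (\<eta>1 * \<alpha> / (L + 1))"
  have "m \<le> lam k" if "k \<ge> 2" for k
    using that
  proof (induction k rule: dec_induct)
    case (step k)
    let ?d = "norm (w (Suc k) - w k)" and ?D = "norm (A (w (Suc k)) - A (w k))"
    show ?case
    proof (cases "?D > \<eta>0 * \<alpha> / lam k * ?d")
      case True
      have "0 \<le> \<eta>0 * \<alpha> / lam k * ?d"
        using lam_pos[of k] \<alpha>_pos parameters(2,3) by (intro mult_nonneg_nonneg divide_nonneg_pos) auto
      then have D: "0 < ?D" using True by (rule le_less_trans)
      have "?D \<le> L * ?d"
        using lipschitz_on_normD[OF lipschitz, of "w (Suc k)" "w k"] w_interior w_edom_g step by simp
      also have "\<dots> \<le> (L + 1) * ?d" by (simp add: algebra_simps)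
      finally have "\<eta>1 * \<alpha> * ?D \<le> \<eta>1 * \<alpha> * ((L + 1) * ?d)"
        using parameters(2) \<alpha>_pos by (intro mult_left_mono) auto
      then have "\<eta>1 * \<alpha> / (L + 1) \<le> \<eta>1 * \<alpha> * (?d / ?D)"
        using D L by (simp add: field_simps)
      then show ?thesis using True by (simp add: lam_Suc m_def)
    next
      case False
      have "lam k \<le> (1 + \<gamma> k) * lam k" using parameters(5)[of k] lam_pos[of k] by simp
      then show ?thesis using False step by (simp add: lam_Suc)
    qed
  qed (simp add: m_def)
  moreover have "0 < m" using lam_pos[of 2] parameters(2) \<alpha>_pos L by (simp add: m_def)
  ultimately show ?thesis by blast
qed

text \<open>
  The reduction of the step size in Step 1 occurs only finitely often: it multiplies the step size by
  at most \<open>\<eta>1 / \<eta>0 < 1\<close>, while the step size is bounded below and its total growth is bounded.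
\<close>

lemma eventually_adaptive_step:
  "\<forall>\<^sub>F k in sequentially. lam (Suc k) = (1 + \<gamma> k) * lam k \<and>
    lam k * norm (A (w (Suc k)) - A (w k)) \<le> \<eta>0 * \<alpha> * norm (w (Suc k) - w k)"
proof -
  obtain m where m: "m > 0" "\<forall>k\<ge>2. m \<le> lam k" using lam_lower_bound by blast
  have "\<forall>\<^sub>F k in sequentially. \<eta>1 / \<eta>0 * lam (k + 2) < lam (Suc k + 2)"
    \<comment> \<open>The shift by 2 is where the lower bound \<open>m\<close> starts to
      hold.\<close>
    by (rule eventually_no_geometric_decrease[where \<gamma> = "\<lambda>k. \<gamma> (k + 2)" and m = m])
       (use m lam_Suc_le parameters summable_ignore_initial_segment[OF parameters(6), of 2]
        in \<open>auto intro: less_imp_le\<close>)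
  then have "\<forall>\<^sub>F k in sequentially. \<eta>1 / \<eta>0 * lam k < lam (Suc k)"
    using eventually_sequentially_seg[of "\<lambda>k. \<eta>1 / \<eta>0 * lam k < lam (Suc k)" 2] by simp
  then show ?thesis by eventually_elim (rule adaptive_step)
qed

section \<open>Estimates relative to a fixed solution\<close>

context
  fixes p :: 'a
  assumes p: "p \<in> vi_solutions A g" "p \<in> edom h"
begin

lemma p_edom_g: "p \<in> edom g"
  using p(1) by (simp add: vi_solutions_def edom_def)

lemma p_solution: "v \<in> edom g \<Longrightarrow> 0 \<le> A p \<bullet> (v - p) + G v - G p"
proof -
  assume v: "v \<in> edom g"
  obtain r s where rs: "g v = ereal r" "g p = ereal s"
    using edomE[OF g(1) v] edomE[OF g(1) p_edom_g] by metis
  have "0 \<le> ereal (A p \<bullet> (v - p)) + g v - g p"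
    using p(1) by (simp add: vi_solutions_def)
  then show ?thesis by (simp add: G_def rs)
qed

lemma p_strong: "v \<in> interior (edom h) \<Longrightarrow> \<sigma> * D p v \<le> (A p - A v) \<bullet> (p - v)"
  using relative_strong[OF p(2), of v] bregman_eq_D[OF p(2) interior_edom, of v] by simp

text \<open>The solution property is tested at \<open>v\<close> and \<open>A p\<close> is exchanged
  for \<open>A v\<close>; relative strong monotonicity turns this exchange into the gain that drives
  the linear rate.\<close>

lemma gap_le:
  assumes "v \<in> edom g" "v \<in> interior (edom h)"
  shows "A v \<bullet> (p - v) + G p - G v \<le> - \<sigma> * D p v"
  using p_solution[OF assms(1)] p_strong[OF assms(2)]
  by (simp add: inner_diff_left inner_diff_right)

text \<open>One optimality condition tested at the solution, with \<open>A (w k)\<close> replaced by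
  \<open>A\<close> at the new iterate at the cost of the step-size test. It supplies the lower bound
  on the Lyapunov function.\<close>

lemma iterates_low:
  assumes k: "k \<ge> 1"
    and step: "lam k * norm (A (w (Suc k)) - A (w k)) \<le> \<eta>0 * \<alpha> * norm (w (Suc k) - w k)"
  shows "D p (w (Suc k)) \<le> D p (wbar k) - D (w (Suc k)) (wbar k)
    + \<eta>0 * (D (w (Suc k)) (w k) / \<phi> + \<phi> * D p (w (Suc k)))"
proof -
  let ?x = "w (Suc k)"
  note x = step_optimality(1,2)[OF k]
  have \<phi>: "0 < \<phi>" using golden_ratio_facts(2) by simp
  have "lam k * ((A (w k) - A ?x) \<bullet> (p - ?x)) \<le> lam k * (norm (A (w k) - A ?x) * norm (p - ?x))"
    using lam_pos[of k] by (intro mult_left_mono norm_cauchy_schwarz) auto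
  also have "\<dots> \<le> (\<eta>0 * \<alpha> * norm (?x - w k)) * norm (p - ?x)"
    using mult_right_mono[OF step, of "norm (p - ?x)"] by (simp add: norm_minus_commute mult.assoc)
  also have "\<dots> = \<eta>0 * (\<alpha> * (norm (p - ?x) * norm (?x - w k)))" by simp
  \<comment> \<open>With weight \<open>\<phi>\<close>, scaling by \<open>\<phi>\<close> in
    \<open>V_low\<close> produces the coefficients \<open>\<eta>\<close> and
    \<open>\<eta> * (\<phi> + 1)\<close>, the latter from
    \<open>\<phi> * \<phi> = \<phi> + 1\<close>.\<close>
  also have "\<dots> \<le> \<eta>0 * (\<phi> * D p ?x + D ?x (w k) / \<phi>)"
    using parameters(2,3) p(2) x(2) w_interior interior_edom \<phi> by (intro mult_left_mono inner_le_D) auto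
  finally have 1: "lam k * ((A (w k) - A ?x) \<bullet> (p - ?x)) \<le> \<eta>0 * (D ?x (w k) / \<phi> + \<phi> * D p ?x)"
    by (simp add: add.commute)
  have "A ?x \<bullet> (p - ?x) + G p - G ?x \<le> - \<sigma> * D p ?x" by (rule gap_le[OF x])
  also have "\<dots> \<le> 0" using \<sigma>_pos D_nonneg[OF p(2) x(2)] by simp
  finally have "lam k * (A (w k) \<bullet> (p - ?x) + G p - G ?x) \<le> lam k * ((A (w k) - A ?x) \<bullet> (p - ?x))"
    using lam_pos[of k] by (intro mult_left_mono) (auto simp: inner_diff_left)
  then show ?thesis
    using step_optimality(3)[OF k p_edom_g] 1 unfolding three_point by linarith
qed

text \<open>Adds the optimality condition of the later step tested at the solution to that of the
  earlier step tested at the newest iterate. The latter is scaled by \<open>1 + \<gamma> k\<close>,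
  the ratio of the two step sizes, so that the \<open>G\<close> terms at the newest iterate
  cancel.\<close>

lemma iterates_descent:
  assumes k: "k \<ge> 1"
    and lam: "lam (Suc k) = (1 + \<gamma> k) * lam k"
    and step: "lam k * norm (A (w (Suc k)) - A (w k)) \<le> \<eta>0 * \<alpha> * norm (w (Suc k) - w k)"
    and m: "m \<le> lam (Suc k)"
  shows "D p (w (Suc (Suc k))) \<le> D p (wbar (Suc k)) - D (w (Suc (Suc k))) (wbar (Suc k))
    + \<phi> * (1 + \<gamma> k) * (D (w (Suc (Suc k))) (wbar (Suc k)) - D (w (Suc (Suc k))) (w (Suc k))
        - D (w (Suc k)) (wbar (Suc k)))
    + (1 + \<gamma> k) * \<eta>0 * (D (w (Suc (Suc k))) (w (Suc k)) + D (w (Suc k)) (w k))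
    - m * \<sigma> * D p (w (Suc k))"
proof -
  let ?x = "w (Suc (Suc k))" and ?y = "w (Suc k)" and ?z = "w k" and ?l = "lam (Suc k)"
  have k': "Suc k \<ge> 1" by simp
  note x = step_optimality(1,2)[OF k'] and y = step_optimality(1,2)[OF k]
  have "egrad h (wbar k) = \<phi> *\<^sub>R egrad h (wbar (Suc k)) - (\<phi> - 1) *\<^sub>R egrad h ?y"
    using wbar_Suc[of k] by simp
  \<comment> \<open>The averaging rule replaces the old averaged point by the new one, at the price
    of a factor \<open>\<phi>\<close>.\<close>
  then have grad: "egrad h ?y - egrad h (wbar k) = \<phi> *\<^sub>R (egrad h ?y - egrad h (wbar (Suc k)))"
    by (simp add: algebra_simps)
  have 1: "0 \<le> ?l * (A ?y \<bullet> (p - ?x) + G p - G ?x)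
      + (D p (wbar (Suc k)) - D p ?x - D ?x (wbar (Suc k)))"
    using step_optimality(3)[OF k' p_edom_g] unfolding three_point .
  have "0 \<le> lam k * (A ?z \<bullet> (?x - ?y) + G ?x - G ?y)
      + \<phi> * (D ?x (wbar (Suc k)) - D ?x ?y - D ?y (wbar (Suc k)))"
    using step_optimality(3)[OF k x(1)] unfolding grad inner_scaleR_left three_point .
  then have "0 \<le> (1 + \<gamma> k) * (lam k * (A ?z \<bullet> (?x - ?y) + G ?x - G ?y)
      + \<phi> * (D ?x (wbar (Suc k)) - D ?x ?y - D ?y (wbar (Suc k))))"
    using parameters(5)[of k] by (intro mult_nonneg_nonneg) auto
  moreover have distrib: "(1 + \<gamma> k) * (lam k * r + \<phi> * s) = (1 + \<gamma> k) * lam k * r + \<phi> * (1 + \<gamma> k) * s" for r s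
    by (simp add: algebra_simps)
  ultimately have 2: "0 \<le> ?l * (A ?z \<bullet> (?x - ?y) + G ?x - G ?y)
      + \<phi> * (1 + \<gamma> k) * (D ?x (wbar (Suc k)) - D ?x ?y - D ?y (wbar (Suc k)))"
    unfolding lam by (simp only:)
  have "?l * ((A ?y - A ?z) \<bullet> (?y - ?x)) \<le> ?l * (norm (A ?y - A ?z) * norm (?y - ?x))"
    using lam_pos[of "Suc k"] by (intro mult_left_mono norm_cauchy_schwarz) auto
  also have "\<dots> = (1 + \<gamma> k) * ((lam k * norm (A ?y - A ?z)) * norm (?x - ?y))"
    unfolding lam by (simp add: norm_minus_commute mult.assoc)
  also have "\<dots> \<le> (1 + \<gamma> k) * ((\<eta>0 * \<alpha> * norm (?y - ?z)) * norm (?x - ?y))"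
    using parameters(5)[of k] by (intro mult_left_mono mult_right_mono step) auto
  also have "\<dots> = (1 + \<gamma> k) * \<eta>0 * (\<alpha> * (norm (?x - ?y) * norm (?y - ?z)))" by simp
  also have "\<dots> \<le> (1 + \<gamma> k) * \<eta>0 * (1 * D ?x ?y + D ?y ?z / 1)"
    using parameters(2,3) parameters(5)[of k] x(2) y(2) w_interior interior_edom
    by (intro mult_left_mono inner_le_D) auto
  finally have 3: "?l * ((A ?y - A ?z) \<bullet> (?y - ?x)) \<le> (1 + \<gamma> k) * \<eta>0 * (D ?x ?y + D ?y ?z)" by simp
  have "?l * (A ?y \<bullet> (p - ?y) + G p - G ?y) \<le> ?l * (- \<sigma> * D p ?y)"
    using lam_pos[of "Suc k"] gap_le[OF y] by (intro mult_left_mono) auto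
  moreover have "m * (\<sigma> * D p ?y) \<le> ?l * (\<sigma> * D p ?y)"
    using m \<sigma>_pos D_nonneg[OF p(2) y(2)] by (intro mult_right_mono) auto
  ultimately have 4: "?l * (A ?y \<bullet> (p - ?y) + G p - G ?y) \<le> - (m * \<sigma> * D p ?y)" by simp
  have "?l * (A ?y \<bullet> (p - ?x) + G p - G ?x) + ?l * (A ?z \<bullet> (?x - ?y) + G ?x - G ?y)
      = ?l * (A ?y \<bullet> (p - ?y) + G p - G ?y) + ?l * ((A ?y - A ?z) \<bullet> (?y - ?x))"
    by (simp add: inner_diff_left inner_diff_right algebra_simps)
  then show ?thesis using 1 2 3 4 by linarith
qed

text \<open>Two uses of \<open>average_identity\<close>: comparing the solution with
  \<open>w (Suc k)\<close>, where one distance vanishes, and comparing \<open>w (Suc k)\<close> with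
  \<open>wbar (Suc k)\<close>, where the remaining terms are nonnegative. Multiplying by
  \<open>\<phi>\<close> then uses \<open>\<phi> * (\<phi> - 1) = 1\<close>.\<close>

lemma iterates_average:
  shows "D p (w (Suc k)) = (\<phi> + 1) * D p (wbar (Suc k)) - \<phi> * D p (wbar k)
      + \<phi> * D (w (Suc k)) (wbar k) - (\<phi> + 1) * D (w (Suc k)) (wbar (Suc k))"
    and "(\<phi> + 1) * D (w (Suc k)) (wbar (Suc k)) \<le> \<phi> * D (w (Suc k)) (wbar k)"
proof -
  let ?x = "w (Suc k)" and ?z = "wbar (Suc k)"
  note \<phi> = golden_ratio_facts
  have [simp]: "D x x = 0" for x by (simp add: D_def)
  have eq: "(\<phi> - 1) * D p ?x + D p (wbar k) - \<phi> * D p ?z = D ?x (wbar k) - \<phi> * D ?x ?z"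
    using average_identity[OF wbar_Suc[of k], of p ?x] by simp
  have "\<phi> * (\<phi> - 1) * D p ?x + \<phi> * D p (wbar k) - (\<phi> * \<phi>) * D p ?z = \<phi> * D ?x (wbar k) - (\<phi> * \<phi>) * D ?x ?z"
    using arg_cong[OF eq, of "\<lambda>t. \<phi> * t"] by (simp add: algebra_simps)
  moreover have "\<phi> * (\<phi> - 1) = 1" using \<phi>(1) by (simp add: algebra_simps)
  ultimately show "D p ?x = (\<phi> + 1) * D p ?z - \<phi> * D p (wbar k) + \<phi> * D ?x (wbar k) - (\<phi> + 1) * D ?x ?z"
    unfolding \<phi>(1) by simp
  have "D ?x (wbar k) - \<phi> * D ?x ?z = (\<phi> - 1) * D ?z ?x + D ?z (wbar k)"
    using average_identity[OF wbar_Suc[of k], of ?x ?z] by simp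
  also have "\<dots> \<ge> 0"
    using \<phi>(2) D_nonneg[of ?z] wbar_interior w_interior interior_edom by (intro add_nonneg_nonneg mult_nonneg_nonneg) auto
  finally have "\<phi> * (\<phi> * D ?x ?z) \<le> \<phi> * D ?x (wbar k)" using \<phi>(2) by (intro mult_left_mono) auto
  then show "(\<phi> + 1) * D ?x ?z \<le> \<phi> * D ?x (wbar k)" by (simp flip: \<phi>(1) mult.assoc)
qed

lemma R_linear_convergence: "R_linearly_convergent w p" "R_linearly_convergent wbar p"
proof -
  note \<phi> = golden_ratio_facts
  have \<eta>0: "0 < \<eta>0" "\<eta>0 < 1" "\<eta>0 < \<phi> / 2" using parameters(2-4) \<phi> by auto
  obtain m where m: "m > 0" "\<forall>k\<ge>2. m \<le> lam k" using lam_lower_bound by blast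
  have "\<gamma> \<longlonglongrightarrow> 0" using parameters(6) by (rule summable_LIMSEQ_zero)
  then have "(\<lambda>k. \<phi> * \<gamma> k) \<longlonglongrightarrow> \<phi> * 0" "(\<lambda>k. (1 + \<gamma> k) * \<eta>0) \<longlonglongrightarrow> (1 + 0) * \<eta>0"
    by (intro tendsto_intros; assumption)+
  moreover have "\<phi> * 0 < 1 - 1 / \<phi>" "(1 + 0) * \<eta>0 < \<phi> / 2" using \<phi> \<eta>0 by auto
  ultimately have "\<forall>\<^sub>F k in sequentially. \<phi> * \<gamma> k < 1 - 1 / \<phi>" "\<forall>\<^sub>F k in sequentially. (1 + \<gamma> k) * \<eta>0 < \<phi> / 2"
    by (simp_all only: order_tendstoD(2))
  with eventually_adaptive_step eventually_ge_at_top[of 1]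
  have "\<forall>\<^sub>F k in sequentially. (lam (Suc k) = (1 + \<gamma> k) * lam k \<and>
      lam k * norm (A (w (Suc k)) - A (w k)) \<le> \<eta>0 * \<alpha> * norm (w (Suc k) - w k)) \<and>
      \<phi> * \<gamma> k \<le> 1 - 1 / \<phi> \<and> (1 + \<gamma> k) * \<eta>0 \<le> \<phi> / 2 \<and> k \<ge> 1"
    by eventually_elim auto
  then obtain K where K: "\<And>k. k \<ge> K \<Longrightarrow> (lam (Suc k) = (1 + \<gamma> k) * lam k \<and>
      lam k * norm (A (w (Suc k)) - A (w k)) \<le> \<eta>0 * \<alpha> * norm (w (Suc k) - w k)) \<and>
      \<phi> * \<gamma> k \<le> 1 - 1 / \<phi> \<and> (1 + \<gamma> k) * \<eta>0 \<le> \<phi> / 2 \<and> k \<ge> 1"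
    unfolding eventually_sequentially by blast
  have nonneg: "0 \<le> D x y" if "x = p \<or> x \<in> range w" "y \<in> range w \<union> range wbar" for x y
    using that p(2) w_interior wbar_interior interior_edom by (intro D_nonneg) auto
  have "\<exists>q W \<epsilon>. 0 < q \<and> q < 1 \<and> 0 < \<epsilon> \<and> (\<forall>k>Suc K. W (Suc k) \<le> q * W k \<and>
      \<epsilon> * D p (wbar k) \<le> W k \<and> \<epsilon> * D p (w k) \<le> W k)"
  \<comment> \<open>Index \<open>k\<close> here corresponds to \<open>iterates_descent\<close> at
    \<open>k - 1\<close>, hence the shifted \<open>\<gamma>\<close> and the threshold
    \<open>Suc K\<close>. At index 0 the truncated subtraction is harmless: there only nonnegativity
    of \<open>c\<close> and \<open>d\<close> is required.\<close>
  proof (rule golden_ratio_contraction[where \<phi> = \<phi> and \<eta> = \<eta>0 and \<mu> = "m * \<sigma>"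
        and a = "\<lambda>k. D p (wbar k)" and b = "\<lambda>k. D (w k) (wbar k)" and c = "\<lambda>k. D (w k) (wbar (k - 1))"
        and d = "\<lambda>k. D (w k) (w (k - 1))" and e = "\<lambda>k. D p (w k)" and \<gamma> = "\<lambda>k. \<gamma> (k - 1)" and K = "Suc K"])
    fix k assume "k \<ge> Suc K"
    then obtain j where j: "k = Suc j" "j \<ge> K" by (cases k) auto
    note Kj = K[OF j(2)]
    show "\<phi> * \<gamma> (k - 1) \<le> 1 - 1 / \<phi>" "(1 + \<gamma> (k - 1)) * \<eta>0 \<le> \<phi> / 2" using Kj j by auto
    have "2 \<le> Suc j" using Kj by linarith
    then have mj: "m \<le> lam (Suc j)" using m(2) by blast
    show "D p (w (Suc k)) \<le> D p (wbar k) - D (w (Suc k)) (wbar (Suc k - 1))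
        + \<phi> * (1 + \<gamma> (k - 1)) * (D (w (Suc k)) (wbar (Suc k - 1)) - D (w (Suc k)) (w (Suc k - 1)) - D (w k) (wbar k))
        + (1 + \<gamma> (k - 1)) * \<eta>0 * (D (w (Suc k)) (w (Suc k - 1)) + D (w k) (w (k - 1))) - m * \<sigma> * D p (w k)"
      using iterates_descent[of j m] Kj mj by (simp add: j)
    show "D p (w (Suc k)) \<le> D p (wbar k) - D (w (Suc k)) (wbar (Suc k - 1))
        + \<eta>0 * (D (w (Suc k)) (w (Suc k - 1)) / \<phi> + \<phi> * D p (w (Suc k)))"
      using iterates_low[of k] K[of k] j by simp
  qed (use \<phi> \<eta>0 m \<sigma>_pos nonneg parameters(5) iterates_average in \<open>auto intro: less_imp_le\<close>)
  then obtain q W \<epsilon> where q: "0 < q" "q < 1" and \<epsilon>: "0 < \<epsilon>"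
    and W: "\<And>k. k > Suc K \<Longrightarrow> W (Suc k) \<le> q * W k \<and> \<epsilon> * D p (wbar k) \<le> W k \<and> \<epsilon> * D p (w k) \<le> W k"
    by blast
  \<comment> \<open>Strong convexity converts the decay of the Bregman distances into decay of
    squared norms.\<close>
  have D_le: "\<epsilon> * \<alpha> / 2 * (norm (v - p))\<^sup>2 \<le> \<epsilon> * D p v" if "v \<in> interior (edom h)" for v
    using mult_left_mono[OF D_ge[OF p(2) that], of \<epsilon>] \<epsilon> by (simp add: norm_minus_commute)
  have pos: "0 < \<epsilon> * \<alpha> / 2" using \<epsilon> \<alpha>_pos by simp
  show "R_linearly_convergent w p"
    by (rule R_linearly_convergentI[where K = "Suc (Suc K)" and V = W, OF q pos])
       (use W order_trans[OF D_le[OF w_interior]] in auto)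
  show "R_linearly_convergent wbar p"
    by (rule R_linearly_convergentI[where K = "Suc (Suc K)" and V = W, OF q pos])
       (use W order_trans[OF D_le[OF wbar_interior]] in auto)
qed

end

end

lemma R_linearly_convergent_LIMSEQ:
  assumes "R_linearly_convergent x l"
  shows "x \<longlonglongrightarrow> l"
proof -
  obtain C q where Cq: "0 < q" "q < 1" "\<And>k. norm (x k - l) \<le> C * q ^ k"
    using assms by (auto simp: R_linearly_convergent_def)
  have "(\<lambda>k. C * q ^ k) \<longlonglongrightarrow> 0"
    using Cq by (intro tendsto_mult_right_zero LIMSEQ_realpow_zero) auto
  then have "(\<lambda>k. x k - l) \<longlonglongrightarrow> 0" by (rule Lim_null_comparison[rotated]) (use Cq in auto)
  then show ?thesis by (simp add: LIM_zero_iff)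
qed

theorem theorem3p5:
  fixes A :: "'a::euclidean_space \<Rightarrow> 'a"
    and g h :: "'a \<Rightarrow> ereal"
    and \<alpha> L \<sigma> \<eta>0 \<eta>1 :: real
    and \<gamma> lam :: "nat \<Rightarrow> real"
    and w wbar :: "nat \<Rightarrow> 'a"
  assumes A1: "proper_fun g" "econvex g" "lsc_fun g"
    and A2: "cont_diff_on_int_dom h" "legendre_fun h" "\<alpha> > 0" "strongly_econvex \<alpha> h"
      "\<And>(un :: nat \<Rightarrow> 'a) u. (\<forall>n. un n \<in> interior (edom h)) \<Longrightarrow> un \<longlonglongrightarrow> u \<Longrightarrow> u \<in> edom h
         \<Longrightarrow> (\<lambda>n. bregman h u (un n)) \<longlonglongrightarrow> 0"
    and A3: "monotone_operator_on (edom g \<inter> interior (edom h)) A"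
      "L-lipschitz_on (edom g \<inter> interior (edom h)) A"
      "edom g \<inter> interior (edom h) \<noteq> {}"
    and A4: "vi_solutions A g \<inter> edom h \<noteq> {}"
    and sigma: "\<sigma> > 0"
      "\<And>z v. z \<in> edom h \<Longrightarrow> v \<in> interior (edom h) \<Longrightarrow>
         ereal \<sigma> * bregman h z v \<le> ereal ((A z - A v) \<bullet> (z - v))"
    and algorithm: "modified_bgraal A g h \<alpha> \<eta>0 \<eta>1 \<gamma> lam w wbar"
  shows "\<exists>p. vi_solutions A g \<inter> edom h = {p} \<and>
           R_linearly_convergent w p \<and> R_linearly_convergent wbar p"
proof -
  interpret bgraal_run h \<alpha> A g L \<sigma> \<eta>0 \<eta>1 \<gamma> lam w wbar
    using A1 A2 A3 sigma algorithm by unfold_locales (auto simp: legendre_fun_def)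
  obtain p where p: "p \<in> vi_solutions A g" "p \<in> edom h" using A4 by blast
  have "p' = p" if "p' \<in> vi_solutions A g" "p' \<in> edom h" for p'
    using R_linear_convergence(1)[OF p] R_linear_convergence(1)[OF that]
    by (meson LIMSEQ_unique R_linearly_convergent_LIMSEQ)
  then show ?thesis using p R_linear_convergence[OF p] by blast
qed

end
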